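(* Let $\Upsilon$ be a tree and suppose there exists an increasing function $\rho:\Upsilon\to\mathbb{R}$ which is constant on no strictly increasing sequence $t_1\prec t_2\prec t_3\prec\cdots$ in $\Upsilon$. Then there is an equivalent norm on $C_0(\Upsilon)$ whose dual norm (on $C_0(\Upsilon)^*\cong\ell_1(\Upsilon)$) is strictly convex.
   Context: A tree is a partially ordered set $(\Upsilon,\preceq)$ such that for each $t\in\Upsilon$ the set $\{s: s\preceq t\}$ is well-ordered by $\preceq$; write $(0,t]=\{s:s\preceq t\}$, $(0,t)=\{s:s\prec t\}$, and let $r(t)$ be the order type of $(0,t)$. Trees are assumed Hausdorff: if $r(t)$ is a limit ordinal and $(0,t)=(0,t')$ then $t=t'$. $\Upsilon$ carries the coarsest topology in which every $(0,t]$ is open and closed. $C_0(\Upsilon)$ is the Banach space of continuous $f:\Upsilon\to\mathbb{R}$ such that $\{t:|f(t)|\ge\epsilon\}$ is compact for all $\epsilon>0$, with the supremum norm. A function $\rho$ is increasing if $s\preceq t$ implies $\rho(s)\le\rho(t)$. A norm is strictly convex if $\|x\|=\|y\|=\tfrac12\|x+y\|$ implies $x=y$. *)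

theory Defs
  imports "HOL-Analysis.Analysis"
begin

definition tree_lt :: "('a \<Rightarrow> 'a \<Rightarrow> bool) \<Rightarrow> 'a \<Rightarrow> 'a \<Rightarrow> bool" where
  "tree_lt le s t \<longleftrightarrow> le s t \<and> s \<noteq> t"

definition is_tree :: "('a \<Rightarrow> 'a \<Rightarrow> bool) \<Rightarrow> bool" where
  "is_tree le \<longleftrightarrow>
     (\<forall>t. le t t) \<and>
     (\<forall>s t. le s t \<longrightarrow> le t s \<longrightarrow> s = t) \<and>
     (\<forall>s t u. le s t \<longrightarrow> le t u \<longrightarrow> le s u) \<and>
     \<comment> \<open>each (0,t] is well-ordered: linearly ordered, every nonempty subset has a least element\<close>
     (\<forall>t s1 s2. le s1 t \<longrightarrow> le s2 t \<longrightarrow> le s1 s2 \<or> le s2 s1) \<and>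
     (\<forall>t A. A \<subseteq> {s. le s t} \<longrightarrow> A \<noteq> {} \<longrightarrow> (\<exists>m\<in>A. \<forall>a\<in>A. le m a)) \<and>
     \<comment> \<open>Hausdorff: r(t) limit ordinal (i.e. (0,t) nonempty without maximum) and (0,t) = (0,t') imply t = t'\<close>
     (\<forall>t t'. {s. tree_lt le s t} \<noteq> {}
        \<and> (\<forall>s. tree_lt le s t \<longrightarrow> (\<exists>s'. tree_lt le s s' \<and> tree_lt le s' t))
        \<and> {s. tree_lt le s t} = {s. tree_lt le s t'} \<longrightarrow> t = t')"

definition tree_topology :: "('a \<Rightarrow> 'a \<Rightarrow> bool) \<Rightarrow> 'a topology" where
  "tree_topology le = topology_generated_by
      ({{s. le s t} | t. True} \<union> {- {s. le s t} | t. True})"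

definition C0 :: "('a \<Rightarrow> 'a \<Rightarrow> bool) \<Rightarrow> ('a \<Rightarrow> real) set" where
  "C0 le = {f. continuous_map (tree_topology le) euclideanreal f \<and>
               (\<forall>\<epsilon>>0. compactin (tree_topology le) {t. \<epsilon> \<le> \<bar>f t\<bar>})}"

definition supnorm :: "('a \<Rightarrow> real) \<Rightarrow> real" where
  "supnorm f = (SUP t. \<bar>f t\<bar>)"

definition equivalent_norm :: "('a \<Rightarrow> 'a \<Rightarrow> bool) \<Rightarrow> (('a \<Rightarrow> real) \<Rightarrow> real) \<Rightarrow> bool" where
  "equivalent_norm le N \<longleftrightarrow>
     (\<forall>f\<in>C0 le. N f = 0 \<longleftrightarrow> f = (\<lambda>t. 0)) \<and>
     (\<forall>f\<in>C0 le. \<forall>c. N (\<lambda>t. c * f t) = \<bar>c\<bar> * N f) \<and>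
     (\<forall>f\<in>C0 le. \<forall>g\<in>C0 le. N (\<lambda>t. f t + g t) \<le> N f + N g) \<and>
     (\<exists>a b. 0 < a \<and> 0 < b \<and> (\<forall>f\<in>C0 le. a * supnorm f \<le> N f \<and> N f \<le> b * supnorm f))"

text \<open>The dual space: bounded linear functionals on C0(le) (only their values on C0 matter).\<close>
definition C0_dual :: "('a \<Rightarrow> 'a \<Rightarrow> bool) \<Rightarrow> (('a \<Rightarrow> real) \<Rightarrow> real) set" where
  "C0_dual le = {\<phi>.
     (\<forall>f\<in>C0 le. \<forall>g\<in>C0 le. \<phi> (\<lambda>t. f t + g t) = \<phi> f + \<phi> g) \<and>
     (\<forall>f\<in>C0 le. \<forall>c. \<phi> (\<lambda>t. c * f t) = c * \<phi> f) \<and>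
     (\<exists>K. \<forall>f\<in>C0 le. \<bar>\<phi> f\<bar> \<le> K * supnorm f)}"

definition dual_norm :: "('a \<Rightarrow> 'a \<Rightarrow> bool) \<Rightarrow> (('a \<Rightarrow> real) \<Rightarrow> real) \<Rightarrow> (('a \<Rightarrow> real) \<Rightarrow> real) \<Rightarrow> real" where
  "dual_norm le N \<phi> = (SUP f\<in>{f\<in>C0 le. N f \<le> 1}. \<bar>\<phi> f\<bar>)"

definition dual_strictly_convex :: "('a \<Rightarrow> 'a \<Rightarrow> bool) \<Rightarrow> (('a \<Rightarrow> real) \<Rightarrow> real) \<Rightarrow> bool" where
  "dual_strictly_convex le N \<longleftrightarrow>
     (\<forall>\<phi>\<in>C0_dual le. \<forall>\<psi>\<in>C0_dual le.
        dual_norm le N \<phi> = dual_norm le N \<psi> \<and>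
        dual_norm le N \<psi> = dual_norm le N (\<lambda>f. \<phi> f + \<psi> f) / 2
        \<longrightarrow> (\<forall>f\<in>C0 le. \<phi> f = \<psi> f))"

end

theory Submission
  imports Defs
begin

text \<open>
  A functional on \<open>C\<^sub>0\<close> is a measure \<open>a \<in> \<ell>\<^sub>1\<close>. Given countably many families, each consisting of pairwise
  disjoint open sets \<open>U\<close>, weights turn the numbers \<open>\<bar>a\<bar>(U)\<close> into a single element of an \<open>\<ell>\<^sub>2\<close> space
  whose norm is dual to an equivalent norm on \<open>C\<^sub>0\<close>. If the whole space is one of the sets, equality
  in the triangle inequality forces \<open>a\<close> and \<open>b\<close> to have equal signs and \<open>\<bar>a\<bar>(U) = \<bar>b\<bar>(U)\<close> for all \<open>U\<close>.

  It remains to choose enough sets. Besides the isolated points, take for each rational \<open>q\<close> the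
  wedges \<open>{t. u \<preceq> t}\<close> above the isolated \<open>u\<close> with \<open>\<rho> < q\<close> below \<open>u\<close> and \<open>q \<le> \<rho> u\<close>; such \<open>u\<close> form an
  antichain. Along a branch \<open>\<rho>\<close> takes each value only finitely often, so every limit point \<open>w\<close> is
  approached by points \<open>u\<close> of this kind, and its plateau \<open>{t \<succeq> w. \<rho> t = \<rho> w}\<close> contains no
  other limit point. Hence these sets determine \<open>\<bar>a\<bar>\<close>.
\<close>

section \<open>The topology of a tree\<close>

locale hausdorff_tree =
  fixes le :: "'a \<Rightarrow> 'a \<Rightarrow> bool"
  assumes tree: "is_tree le"
begin

abbreviation lt where "lt \<equiv> tree_lt le"
abbreviation X where "X \<equiv> tree_topology le"
abbreviation dn where "dn t \<equiv> {s. le s t}"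
abbreviation up where "up t \<equiv> {s. le t s}"

section \<open>Consequences of the order axioms\<close>

lemma le_refl: "le t t"
  by (rule tree[unfolded is_tree_def, THEN conjunct1, rule_format])

lemma le_antisym: "le s t \<Longrightarrow> le t s \<Longrightarrow> s = t"
  by (rule tree[unfolded is_tree_def, THEN conjunct2, THEN conjunct1, rule_format])

lemma le_trans: "le s t \<Longrightarrow> le t u \<Longrightarrow> le s u"
  by (rule tree[unfolded is_tree_def, THEN conjunct2, THEN conjunct2, THEN conjunct1, rule_format])

lemma le_linear_below: "le s t \<Longrightarrow> le s' t \<Longrightarrow> le s s' \<or> le s' s"
  by (rule tree[unfolded is_tree_def, THEN conjunct2, THEN conjunct2, THEN conjunct2,
        THEN conjunct1, rule_format])

lemma least_below:
  assumes "le s t" "Q s"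
  obtains m where "le m t" "Q m" "\<And>s. le s t \<Longrightarrow> Q s \<Longrightarrow> le m s"
proof -
  have "\<exists>m\<in>{s. le s t \<and> Q s}. \<forall>a\<in>{s. le s t \<and> Q s}. le m a"
    by (rule tree[unfolded is_tree_def, THEN conjunct2, THEN conjunct2, THEN conjunct2,
        THEN conjunct2, THEN conjunct1, rule_format, of _ t]) (use assms in auto)
  then show thesis using that by blast
qed

lemma hausdorff:
  "{s. lt s t} \<noteq> {} \<Longrightarrow> (\<And>s. lt s t \<Longrightarrow> \<exists>s'. lt s s' \<and> lt s' t) \<Longrightarrow>
    {s. lt s t} = {s. lt s t'} \<Longrightarrow> t = t'"
  by (rule tree[unfolded is_tree_def, THEN conjunct2, THEN conjunct2, THEN conjunct2,
        THEN conjunct2, THEN conjunct2, rule_format]) blast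

lemma lt_not_le: "lt s t \<Longrightarrow> \<not> le t s"
  using le_antisym unfolding tree_lt_def by blast

lemma le_lt_trans: "le s t \<Longrightarrow> lt t u \<Longrightarrow> lt s u"
  and lt_le_trans: "lt s t \<Longrightarrow> le t u \<Longrightarrow> lt s u"
  using le_antisym le_trans unfolding tree_lt_def by blast+

lemma lt_imp_le: "lt s t \<Longrightarrow> le s t"
  by (simp add: tree_lt_def)

lemma le_or_lt_below: "le s t \<Longrightarrow> le s' t \<Longrightarrow> le s s' \<or> lt s' s"
  using le_linear_below[of s t s'] by (auto simp: tree_lt_def)

lemma dn_mono: "le s t \<Longrightarrow> dn s \<subseteq> dn t"
  using le_trans by blast

lemma tree_induct [case_names less]:
  assumes "\<And>t. (\<And>s. lt s t \<Longrightarrow> P s) \<Longrightarrow> P t"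
  shows "P t"
proof (rule ccontr)
  assume "\<not> P t"
  then obtain m where m: "le m t" "\<not> P m" "\<And>s. le s t \<Longrightarrow> \<not> P s \<Longrightarrow> le m s"
    using least_below[of t t "\<lambda>s. \<not> P s"] le_refl by blast
  have "P s" if "lt s m" for s
    using m(3)[of s] le_trans[of s m t] m(1) that lt_not_le lt_imp_le by blast
  with assms m(2) show False by blast
qed

text \<open>Roots and immediate successors, that is, the points whose rank is not a limit ordinal.
  They are isolated by \<open>openin_singleton\<close>.\<close>

definition nonlim :: "'a \<Rightarrow> bool" where
  "nonlim t \<longleftrightarrow> (\<forall>s. \<not> lt s t) \<or> (\<exists>p. lt p t \<and> (\<forall>s. lt s t \<longrightarrow> le s p))"

lemma limit_above:
  assumes "\<not> nonlim t" "lt s t"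
  shows "\<exists>s'. lt s s' \<and> lt s' t"
proof -
  obtain s' where "lt s' t" "\<not> le s' s"
    using assms unfolding nonlim_def by blast
  with assms(2) have "lt s s'"
    using le_or_lt_below[of s' t s] by (simp add: lt_imp_le)
  with \<open>lt s' t\<close> show ?thesis by blast
qed

text \<open>The Hausdorff axiom in usable form: a limit point is the least upper bound of its strict
  predecessors. The first point \<open>y\<close> of the branch to \<open>s\<close> that is not
  strictly below \<open>t\<close> has the same strict predecessors as \<open>t\<close>, so the axiom
  identifies the two.\<close>

lemma limit_le:
  assumes lim: "\<not> nonlim t" and below: "\<And>r. lt r t \<Longrightarrow> le r s"
  shows "le t s"
proof -
  have "\<not> lt s t"
    using limit_above[OF lim, of s] below lt_not_le by blast
  then obtain y where y: "le y s" "\<not> lt y t" "\<And>x. le x s \<Longrightarrow> \<not> lt x t \<Longrightarrow> le y x"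
    using least_below[of s s "\<lambda>y. \<not> lt y t"] le_refl by blast
  have "lt x t \<longleftrightarrow> lt x y" for x
  proof
    assume "lt x t"
    then have "le x s" using below by blast
    then show "lt x y"
      using le_or_lt_below[OF y(1), of x] \<open>lt x t\<close> y(2) le_lt_trans[of y x t] by blast
  next
    assume "lt x y"
    then have "le x s" using y(1) le_trans lt_imp_le by blast
    then show "lt x t" using y(3) \<open>lt x y\<close> lt_not_le by blast
  qed
  moreover have "{s. lt s t} \<noteq> {}"
    using lim unfolding nonlim_def by blast
  ultimately have "t = y" using hausdorff[of t y] limit_above[OF lim] by blast
  with y(1) show ?thesis by simp
qed

section \<open>Neighbourhoods and compactness of branches\<close>

lemma topspace_tree [simp]: "topspace X = UNIV"
proof -
  have "x \<in> \<Union> ({dn t | t. True} \<union> {- dn t | t. True})" for x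
    using le_refl by blast
  then show ?thesis
    unfolding tree_topology_def topology_generated_by_topspace by blast
qed

lemma openin_dn: "openin X (dn t)" and openin_compl_dn: "openin X (- dn t)"
  unfolding tree_topology_def by (rule topology_generated_by_Basis; blast)+

lemma closedin_dn: "closedin X (dn t)"
  using openin_compl_dn[of t] by (simp add: closedin_def Compl_eq_Diff_UNIV)

text \<open>Intervals ending at \<open>t\<close> form a neighbourhood base at \<open>t\<close>. In
  the induction over the generated topology only the complement of \<open>dn s\<close> is delicate:
  the first point \<open>m\<close> of the branch to \<open>t\<close> outside \<open>dn s\<close>
  cannot be a limit, by \<open>limit_le\<close>, so its immediate predecessor serves as left end of
  the interval.\<close>

lemma nbhd_interval:
  assumes "openin X U" "t \<in> U"
  shows "dn t \<subseteq> U \<or> (\<exists>p. lt p t \<and> dn t - dn p \<subseteq> U)"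
proof -
  have "generate_topology_on ({dn t | t. True} \<union> {- dn t | t. True}) U"
    using assms(1) unfolding tree_topology_def openin_topology_generated_by_iff .
  then show ?thesis using assms(2)
  proof (induction rule: generate_topology_on.induct)
    case Empty
    then show ?case by simp
  next
    case (Int U V)
    then have "dn t \<subseteq> U \<or> (\<exists>p. lt p t \<and> dn t - dn p \<subseteq> U)"
      "dn t \<subseteq> V \<or> (\<exists>q. lt q t \<and> dn t - dn q \<subseteq> V)" by blast+
    moreover have "\<exists>r. lt r t \<and> dn t - dn r \<subseteq> U \<inter> V"
      if "lt p t" "dn t - dn p \<subseteq> U" "lt q t" "dn t - dn q \<subseteq> V" for p q
    proof -
      have "dn p \<subseteq> dn q \<or> dn q \<subseteq> dn p"
        using le_linear_below[of p t q] that dn_mono lt_imp_le by meson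
      then show ?thesis using that by blast
    qed
    ultimately show ?case by blast
  next
    case (UN K)
    then obtain k where "k \<in> K" "t \<in> k" by blast
    then show ?case using UN.IH[of k] Union_upper[of k K] by (meson subset_trans)
  next
    case (Basis W)
    then consider s where "W = dn s" | s where "W = - dn s" by blast
    then show ?case
    proof cases
      case 1
      then show ?thesis using Basis le_trans by blast
    next
      case 2
      then have "\<not> le t s" using Basis by blast
      then obtain m where m: "le m t" "\<not> le m s" "\<And>x. le x t \<Longrightarrow> \<not> le x s \<Longrightarrow> le m x"
        using least_below[of t t "\<lambda>x. \<not> le x s"] le_refl by blast
      have "le r s" if "lt r m" for r
        using m(3)[of r] that lt_not_le le_trans[of r m t] m(1) lt_imp_le by blast
      then have "nonlim m" using limit_le m(2) by blast
      then consider "\<forall>r. \<not> lt r m" | p where "lt p m" "\<forall>r. lt r m \<longrightarrow> le r p"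
        unfolding nonlim_def by blast
      then show ?thesis
      proof cases
        case 1
        have "dn t \<subseteq> - dn s"
        proof
          fix x assume "x \<in> dn t"
          then have "le m x" using 1 le_or_lt_below[OF m(1), of x] by blast
          then show "x \<in> - dn s" using m(2) le_trans by blast
        qed
        then show ?thesis using \<open>W = - dn s\<close> by blast
      next
        case (2 p)
        have "dn t - dn p \<subseteq> - dn s"
        proof
          fix x assume "x \<in> dn t - dn p"
          then have "le m x" using 2 le_or_lt_below[OF m(1), of x] by blast
          then show "x \<in> - dn s" using m(2) le_trans by blast
        qed
        then show ?thesis using \<open>W = - dn s\<close> 2(1) lt_le_trans[OF _ m(1)] by blast
      qed
    qed
  qed
qed

text \<open>Induction along the branch: the member of the cover around \<open>t\<close> contains all
  of \<open>dn t\<close> except at most some \<open>dn p\<close> with \<open>p\<close> strictly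
  below \<open>t\<close>, which the induction hypothesis covers.\<close>

lemma compactin_dn: "compactin X (dn t)"
proof -
  have "\<exists>\<F>. finite \<F> \<and> \<F> \<subseteq> \<U> \<and> dn t \<subseteq> \<Union>\<F>"
    if "\<forall>U\<in>\<U>. openin X U" "dn t \<subseteq> \<Union>\<U>" for \<U>
    using that(2)
  proof (induction t rule: tree_induct)
    case (less t)
    obtain U where U: "U \<in> \<U>" "t \<in> U" using less(2) le_refl by blast
    with nbhd_interval[of U t] that(1)
    consider "dn t \<subseteq> U" | p where "lt p t" "dn t - dn p \<subseteq> U" by blast
    then show ?case
    proof cases
      case 1
      then show ?thesis using U by (intro exI[of _ "{U}"]) auto
    next
      case (2 p)
      then have "dn p \<subseteq> \<Union>\<U>" using less(2) dn_mono[OF lt_imp_le] by blast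
      then obtain \<F> where "finite \<F>" "\<F> \<subseteq> \<U>" "dn p \<subseteq> \<Union>\<F>"
        using less(1)[OF 2(1)] by blast
      then show ?thesis using U 2(2) by (intro exI[of _ "insert U \<F>"]) auto
    qed
  qed
  then show ?thesis unfolding compactin_def by simp
qed

section \<open>Clopen and compact open sets\<close>

definition clop :: "'a set \<Rightarrow> bool" where
  "clop A \<longleftrightarrow> openin X A \<and> closedin X A"

lemma clop_dn: "clop (dn t)"
  unfolding clop_def using openin_dn closedin_dn by blast

lemma clop_Compl: "clop A \<Longrightarrow> clop (- A)"
  unfolding clop_def
  by (metis Compl_eq_Diff_UNIV closedin_diff closedin_topspace openin_diff openin_topspace topspace_tree)

lemma clop_Int: "clop A \<Longrightarrow> clop B \<Longrightarrow> clop (A \<inter> B)"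
  unfolding clop_def by auto

lemma clop_Diff: "clop A \<Longrightarrow> clop B \<Longrightarrow> clop (A - B)"
  by (simp add: Diff_eq clop_Compl clop_Int)

text \<open>Compact open sets are the supports of test functions: their indicators lie in
  \<open>C0 le\<close>.\<close>

definition kop :: "'a set \<Rightarrow> bool" where
  "kop A \<longleftrightarrow> clop A \<and> compactin X A"

lemma kop_Int_clop: "kop A \<Longrightarrow> clop B \<Longrightarrow> kop (A \<inter> B)"
  unfolding kop_def by (metis clop_Int clop_def closed_Int_compactin inf_commute)

lemma kop_dn: "kop (dn t)"
  unfolding kop_def using clop_dn compactin_dn by blast

lemma kop_nbhd:
  assumes "openin X U" "t \<in> U"
  obtains A where "kop A" "t \<in> A" "A \<subseteq> U"
proof -
  consider "dn t \<subseteq> U" | p where "lt p t" "dn t - dn p \<subseteq> U"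
    using nbhd_interval[OF assms] by blast
  then show thesis
  proof cases
    case 1
    then show thesis using that[of "dn t"] kop_dn le_refl by blast
  next
    case (2 p)
    have "kop (dn t - dn p)"
      using kop_Int_clop[OF kop_dn clop_Compl[OF clop_dn]] by (simp add: Diff_eq)
    then show thesis using that[of "dn t - dn p"] le_refl lt_not_le[OF 2(1)] 2(2) by blast
  qed
qed

lemma openin_Compl_singleton: "openin X (- {t})"
proof (subst openin_subopen, intro ballI)
  fix s assume "s \<in> - {t}"
  then show "\<exists>T. openin X T \<and> s \<in> T \<and> T \<subseteq> - {t}"
  proof (cases "le t s")
    case True
    then have "openin X (- dn t)" "s \<in> - dn t"
      using openin_compl_dn \<open>s \<in> - {t}\<close> le_antisym by auto
    then show ?thesis using le_refl by blast
  next
    case False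
    then show ?thesis using openin_dn[of s] le_refl by blast
  qed
qed

lemma openin_Compl_finite: "finite T \<Longrightarrow> openin X (- T)"
proof (induction T rule: finite_induct)
  case empty
  then show ?case using openin_topspace[of X] by simp
next
  case (insert t T)
  have "- insert t T = - {t} \<inter> - T" by auto
  then show ?case using insert openin_Compl_singleton[of t] by (metis openin_Int)
qed

text \<open>Points are added one at a time. The neighbourhood \<open>B\<close> of the new point
  avoids the finitely many old points, so it can be removed from the old neighbourhoods without
  losing their centres; they stay compact and open because \<open>B\<close> is clopen.\<close>

lemma disjoint_kop_nbhds:
  assumes "finite T" "\<forall>t\<in>T. openin X (O' t) \<and> t \<in> O' t"
  obtains A where "\<And>t. t \<in> T \<Longrightarrow> kop (A t) \<and> t \<in> A t \<and> A t \<subseteq> O' t"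
    "\<And>s t. s \<in> T \<Longrightarrow> t \<in> T \<Longrightarrow> s \<noteq> t \<Longrightarrow> A s \<inter> A t = {}"
proof -
  have "\<exists>A. (\<forall>t\<in>T. kop (A t) \<and> t \<in> A t \<and> A t \<subseteq> O' t) \<and>
      (\<forall>s\<in>T. \<forall>t\<in>T. s \<noteq> t \<longrightarrow> A s \<inter> A t = {})"
    using assms
  proof (induction T rule: finite_induct)
    case empty
    then show ?case by simp
  next
    case (insert x T)
    have "\<forall>t\<in>T. openin X (O' t) \<and> t \<in> O' t" using insert.prems by simp
    from insert.IH[OF this]
    obtain A where A: "\<forall>t\<in>T. kop (A t) \<and> t \<in> A t \<and> A t \<subseteq> O' t"
        "\<forall>s\<in>T. \<forall>t\<in>T. s \<noteq> t \<longrightarrow> A s \<inter> A t = {}" by (elim exE conjE)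
    have "openin X (O' x \<inter> - T)"
      using insert.prems openin_Compl_finite[OF insert.hyps(1)] by (simp add: openin_Int)
    moreover have "x \<in> O' x \<inter> - T"
      using insert.prems insert.hyps(2) by simp
    ultimately obtain B where B: "kop B" "x \<in> B" "B \<subseteq> O' x \<inter> - T"
      using kop_nbhd by metis
    define A' where "A' t = (if t = x then B else A t \<inter> - B)" for t
    have "clop (- B)" using B(1) clop_Compl kop_def by simp
    then have "kop (A t \<inter> - B)" if "t \<in> T" for t
      using A(1) that kop_Int_clop by simp
    then have "\<forall>t\<in>insert x T. kop (A' t) \<and> t \<in> A' t \<and> A' t \<subseteq> O' t"
      using A(1) B unfolding A'_def by auto
    moreover have "\<forall>s\<in>insert x T. \<forall>t\<in>insert x T. s \<noteq> t \<longrightarrow> A' s \<inter> A' t = {}"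
      using A(2) unfolding A'_def by auto
    ultimately show ?case by (intro exI conjI)
  qed
  then obtain A where "\<forall>t\<in>T. kop (A t) \<and> t \<in> A t \<and> A t \<subseteq> O' t"
      "\<forall>s\<in>T. \<forall>t\<in>T. s \<noteq> t \<longrightarrow> A s \<inter> A t = {}" by (elim exE conjE)
  then show thesis by (intro that[of A]) auto
qed

text \<open>Deleting the immediate predecessor of \<open>t\<close> from a branch through
  \<open>t\<close> leaves exactly the part from \<open>t\<close> on. At a limit \<open>t\<close> no
  such cut exists, which is why wedges are only taken above isolated points.\<close>

lemma openin_up:
  assumes "nonlim t"
  shows "openin X (up t)"
proof (subst openin_subopen, intro ballI)
  fix x assume x: "x \<in> up t"
  consider "\<forall>r. \<not> lt r t" | p where "lt p t" "\<forall>r. lt r t \<longrightarrow> le r p"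
    using assms unfolding nonlim_def by blast
  then show "\<exists>T. openin X T \<and> x \<in> T \<and> T \<subseteq> up t"
  proof cases
    case 1
    then have "dn x \<subseteq> up t" using le_or_lt_below[of t x] x by blast
    then show ?thesis using openin_dn[of x] le_refl by blast
  next
    case (2 p)
    then have "dn x - dn p \<subseteq> up t" using le_or_lt_below[of t x] x by blast
    moreover have "x \<in> dn x - dn p"
      using x 2(1) lt_le_trans lt_not_le le_refl by blast
    moreover have "openin X (dn x - dn p)"
      using clop_Diff[OF clop_dn clop_dn] clop_def by blast
    ultimately show ?thesis by blast
  qed
qed

lemma openin_singleton:
  assumes "nonlim t"
  shows "openin X {t}"
proof -
  have "{t} = up t \<inter> dn t" using le_refl le_antisym by blast
  then show ?thesis using openin_up[OF assms] openin_dn by (metis openin_Int)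
qed

section \<open>Functionals on \<open>C\<^sub>0\<close>\<close>

abbreviation C where "C \<equiv> C0 le"

section \<open>Closure properties of the function space\<close>

lemma closedin_abs_ge:
  assumes "continuous_map X euclideanreal f"
  shows "closedin X {t. \<epsilon> \<le> \<bar>f t\<bar>}"
proof -
  have "closedin X {t \<in> topspace X. \<bar>f t\<bar> \<in> {\<epsilon>..}}"
    by (intro closedin_continuous_map_preimage[where Y = euclideanreal] continuous_map_real_abs assms) simp
  then show ?thesis by simp
qed

lemma C0_continuous: "f \<in> C \<Longrightarrow> continuous_map X euclideanreal f"
  and C0_compact: "f \<in> C \<Longrightarrow> 0 < \<epsilon> \<Longrightarrow> compactin X {t. \<epsilon> \<le> \<bar>f t\<bar>}"
  unfolding C0_def by auto

lemma C0_zero: "(\<lambda>t. 0) \<in> C"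
  unfolding C0_def by (auto simp: not_le[symmetric])

lemma C0_add:
  assumes "f \<in> C" "g \<in> C"
  shows "(\<lambda>t. f t + g t) \<in> C"
proof -
  have cont: "continuous_map X euclideanreal (\<lambda>t. f t + g t)"
    using assms C0_continuous by (intro continuous_map_add) auto
  have "compactin X {t. \<epsilon> \<le> \<bar>f t + g t\<bar>}" if "0 < \<epsilon>" for \<epsilon>
  proof (rule closed_compactin)
    show "compactin X ({t. \<epsilon> / 2 \<le> \<bar>f t\<bar>} \<union> {t. \<epsilon> / 2 \<le> \<bar>g t\<bar>})"
      by (intro compactin_Un C0_compact assms half_gt_zero that)
    show "closedin X {t. \<epsilon> \<le> \<bar>f t + g t\<bar>}" using closedin_abs_ge[OF cont] .
  qed auto
  with cont show ?thesis unfolding C0_def by simp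
qed

lemma C0_scale:
  assumes "f \<in> C"
  shows "(\<lambda>t. c * f t) \<in> C"
proof (cases "c = 0")
  case True
  then show ?thesis using C0_zero by simp
next
  case False
  have "compactin X {t. \<epsilon> \<le> \<bar>c * f t\<bar>}" if "0 < \<epsilon>" for \<epsilon>
  proof -
    have "{t. \<epsilon> \<le> \<bar>c * f t\<bar>} = {t. \<epsilon> / \<bar>c\<bar> \<le> \<bar>f t\<bar>}"
      using False by (auto simp: abs_mult field_simps)
    then show ?thesis using C0_compact[OF assms, of "\<epsilon> / \<bar>c\<bar>"] False that by simp
  qed
  then show ?thesis
    using C0_continuous[OF assms] unfolding C0_def by (auto intro: continuous_map_real_mult)
qed

lemma C0_diff: "f \<in> C \<Longrightarrow> g \<in> C \<Longrightarrow> (\<lambda>t. f t - g t) \<in> C"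
  using C0_add[of f "\<lambda>t. -1 * g t"] C0_scale[of g "-1"] by simp

lemma continuous_map_indicator:
  assumes "clop A"
  shows "continuous_map X euclideanreal (indicat_real A)"
  unfolding continuous_map_def
proof (intro conjI allI impI)
  fix U :: "real set"
  have "{x \<in> topspace X. indicat_real A x \<in> U} =
      (if 1 \<in> U then A else {}) \<union> (if 0 \<in> U then - A else {})"
    by (auto simp: indicator_def)
  moreover have "openin X A" "openin X (- A)"
    using assms clop_Compl unfolding clop_def by blast+
  ultimately show "openin X {x \<in> topspace X. indicat_real A x \<in> U}"
    by (simp add: openin_Un)
qed simp

lemma C0_restrict:
  assumes "f \<in> C" "clop A"
  shows "(\<lambda>t. indicat_real A t * f t) \<in> C"
proof -
  have "compactin X {t. \<epsilon> \<le> \<bar>indicat_real A t * f t\<bar>}" if "0 < \<epsilon>" for \<epsilon>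
  proof -
    have "{t. \<epsilon> \<le> \<bar>indicat_real A t * f t\<bar>} = A \<inter> {t. \<epsilon> \<le> \<bar>f t\<bar>}"
      using that by (auto simp: indicator_def)
    then show ?thesis
      using closed_Int_compactin[OF _ C0_compact[OF assms(1) that], of A] assms(2) clop_def by simp
  qed
  then show ?thesis
    using continuous_map_indicator[OF assms(2)] C0_continuous[OF assms(1)]
    unfolding C0_def by (auto intro: continuous_map_real_mult)
qed

lemma C0_indicator:
  assumes "kop A"
  shows "indicat_real A \<in> C"
proof -
  have "compactin X {t. \<epsilon> \<le> \<bar>indicat_real A t\<bar>}" if "0 < \<epsilon>" for \<epsilon>
  proof (rule closed_compactin)
    show "compactin X A" using assms kop_def by simp
    show "closedin X {t. \<epsilon> \<le> \<bar>indicat_real A t\<bar>}"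
      using assms by (intro closedin_abs_ge continuous_map_indicator) (simp add: kop_def)
  qed (use that in \<open>auto simp: indicator_def split: if_splits\<close>)
  then show ?thesis
    using continuous_map_indicator[of A] assms unfolding C0_def kop_def by simp
qed

lemma C0_sum:
  "finite T \<Longrightarrow> (\<And>i. i \<in> T \<Longrightarrow> g i \<in> C) \<Longrightarrow> (\<lambda>s. \<Sum>i\<in>T. c i * g i s) \<in> C"
proof (induction T rule: finite_induct)
  case empty
  then show ?case using C0_zero by simp
next
  case (insert x T)
  then have "(\<lambda>s. c x * g x s + (\<Sum>i\<in>T. c i * g i s)) \<in> C"
    by (intro C0_add C0_scale) auto
  then show ?case using insert by simp
qed

text \<open>On the compact set where \<open>\<bar>f t\<bar>\<close> is at least 1 the continuous
  \<open>f\<close> is bounded; elsewhere 1 is a bound.\<close>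

lemma C0_bounded:
  assumes "f \<in> C"
  obtains M where "\<And>t. \<bar>f t\<bar> \<le> M"
proof -
  have "compactin euclideanreal (f ` {t. 1 \<le> \<bar>f t\<bar>})"
    by (intro image_compactin[where X = X] C0_compact C0_continuous assms zero_less_one)
  then have "bounded (f ` {t. 1 \<le> \<bar>f t\<bar>})" by (simp add: compact_imp_bounded)
  then obtain B where B: "\<And>t. 1 \<le> \<bar>f t\<bar> \<Longrightarrow> \<bar>f t\<bar> \<le> B"
    unfolding bounded_iff by auto
  have "\<bar>f t\<bar> \<le> max 1 B" for t
    using B[of t] by (cases "1 \<le> \<bar>f t\<bar>") auto
  then show thesis by (rule that)
qed

lemma abs_le_supnorm: "f \<in> C \<Longrightarrow> \<bar>f t\<bar> \<le> supnorm f"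
  unfolding supnorm_def by (metis C0_bounded cSUP_upper UNIV_I bdd_aboveI2)

lemma supnorm_le: "(\<And>t. \<bar>f t\<bar> \<le> M) \<Longrightarrow> supnorm f \<le> M"
  unfolding supnorm_def by (rule cSUP_least) auto

section \<open>Bounded functionals and their point masses\<close>

lemma dual_add: "\<phi> \<in> C0_dual le \<Longrightarrow> f \<in> C \<Longrightarrow> g \<in> C \<Longrightarrow> \<phi> (\<lambda>t. f t + g t) = \<phi> f + \<phi> g"
  and dual_scale: "\<phi> \<in> C0_dual le \<Longrightarrow> f \<in> C \<Longrightarrow> \<phi> (\<lambda>t. c * f t) = c * \<phi> f"
  unfolding C0_dual_def by auto

lemma dual_zero: "\<phi> \<in> C0_dual le \<Longrightarrow> \<phi> (\<lambda>t. 0) = 0"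
  using dual_scale[OF _ C0_zero, of \<phi> 0] by simp

lemma dual_diff:
  "\<phi> \<in> C0_dual le \<Longrightarrow> f \<in> C \<Longrightarrow> g \<in> C \<Longrightarrow> \<phi> (\<lambda>t. f t - g t) = \<phi> f - \<phi> g"
  using dual_add[of \<phi> f "\<lambda>t. -1 * g t"] dual_scale[of \<phi> g "-1"] C0_scale[of g "-1"] by simp

lemma dual_split:
  assumes "\<phi> \<in> C0_dual le" "f \<in> C" "clop A"
  shows "\<phi> f = \<phi> (\<lambda>t. indicat_real A t * f t) + \<phi> (\<lambda>t. indicat_real (- A) t * f t)"
proof -
  have "f = (\<lambda>t. indicat_real A t * f t + indicat_real (- A) t * f t)"
    by (auto simp: indicator_def)
  then show ?thesis
    using dual_add[OF assms(1) C0_restrict[OF assms(2,3)] C0_restrict[OF assms(2) clop_Compl[OF assms(3)]]]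
    by metis
qed

lemma dual_sum:
  assumes "\<phi> \<in> C0_dual le" "finite T" "\<And>i. i \<in> T \<Longrightarrow> g i \<in> C"
  shows "\<phi> (\<lambda>s. \<Sum>i\<in>T. c i * g i s) = (\<Sum>i\<in>T. c i * \<phi> (g i))"
  using assms(2,3)
proof (induction T rule: finite_induct)
  case empty
  then show ?case using dual_zero[OF assms(1)] by simp
next
  case (insert x T)
  have "\<phi> (\<lambda>s. c x * g x s + (\<Sum>i\<in>T. c i * g i s)) =
      \<phi> (\<lambda>s. c x * g x s) + \<phi> (\<lambda>s. \<Sum>i\<in>T. c i * g i s)"
    using insert by (intro dual_add assms(1) C0_scale C0_sum) auto
  then show ?case
    using insert dual_scale[OF assms(1)] by simp
qed

text \<open>Taking the absolute value of the constant lets any pointwise bound \<open>M\<close>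
  replace \<open>supnorm f\<close>.\<close>

lemma dual_bound:
  assumes "\<phi> \<in> C0_dual le"
  obtains K where "0 \<le> K" "\<And>f M. f \<in> C \<Longrightarrow> (\<And>t. \<bar>f t\<bar> \<le> M) \<Longrightarrow> \<bar>\<phi> f\<bar> \<le> K * M"
proof -
  obtain K where K: "\<forall>f\<in>C. \<bar>\<phi> f\<bar> \<le> K * supnorm f"
    using assms unfolding C0_dual_def by auto
  have "\<bar>\<phi> f\<bar> \<le> \<bar>K\<bar> * M" if "f \<in> C" "\<And>t. \<bar>f t\<bar> \<le> M" for f M
  proof -
    have "0 \<le> supnorm f" using abs_le_supnorm[OF that(1), of undefined] by linarith
    have "\<bar>\<phi> f\<bar> \<le> K * supnorm f" using K that(1) by blast
    also have "\<dots> \<le> \<bar>K\<bar> * M"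
      using supnorm_le[of f M] that(2) \<open>0 \<le> supnorm f\<close> by (intro mult_mono) auto
    finally show ?thesis .
  qed
  then show thesis using that[of "\<bar>K\<bar>"] by simp
qed

text \<open>If \<open>g\<close> almost attains the supremum of \<open>\<phi>\<close> over the functions of the unit ball that vanish
  near \<open>t\<close>, there is no room left for \<open>\<phi>\<close> on functions that are supported where \<open>g\<close> vanishes.\<close>

lemma dual_punctured_nbhd:
  assumes \<phi>: "\<phi> \<in> C0_dual le" and "0 < \<epsilon>"
  shows "\<exists>A. kop A \<and> t \<in> A \<and>
    (\<forall>f\<in>C. (\<forall>s. \<bar>f s\<bar> \<le> indicator A s) \<longrightarrow> f t = 0 \<longrightarrow> \<bar>\<phi> f\<bar> \<le> \<epsilon>)"
proof -
  obtain K where K: "0 \<le> K" "\<And>f M. f \<in> C \<Longrightarrow> (\<And>t. \<bar>f t\<bar> \<le> M) \<Longrightarrow> \<bar>\<phi> f\<bar> \<le> K * M"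
    using dual_bound[OF \<phi>] by metis
  define G where "G = {g \<in> C. (\<forall>s. \<bar>g s\<bar> \<le> 1) \<and> (\<exists>A. kop A \<and> t \<in> A \<and> (\<forall>s\<in>A. g s = 0))}"
  have bdd: "bdd_above (\<phi> ` G)"
  proof (rule bdd_aboveI2)
    fix g assume "g \<in> G"
    then show "\<phi> g \<le> K * 1" using K(2)[of g 1] unfolding G_def by force
  qed
  have "(\<lambda>s. 0) \<in> G"
    unfolding G_def using C0_zero kop_dn[of t] le_refl by auto
  then have "\<exists>g\<in>G. Sup (\<phi> ` G) - \<epsilon> / 2 < \<phi> g"
    using less_cSUP_iff[OF _ bdd, of "Sup (\<phi> ` G) - \<epsilon> / 2"] assms(2) by auto
  then obtain g A where g: "g \<in> G" "Sup (\<phi> ` G) - \<epsilon> / 2 < \<phi> g"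
    and A: "kop A" "t \<in> A" "\<And>s. s \<in> A \<Longrightarrow> g s = 0" unfolding G_def by auto
  have gC: "g \<in> C" "\<And>s. \<bar>g s\<bar> \<le> 1" using g(1) unfolding G_def by auto
  have up: "\<phi> f \<le> \<epsilon> / 2"
    if f: "f \<in> C" "\<And>s. \<bar>f s\<bar> \<le> indicator A s" and A': "kop A'" "t \<in> A'" "\<And>s. s \<in> A' \<Longrightarrow> f s = 0"
    for f A'
  proof -
    have "\<bar>g s + f s\<bar> \<le> 1" for s
      using f(2)[of s] gC(2)[of s] A(3)[of s] by (cases "s \<in> A") auto
    moreover have "kop (A \<inter> A')" using A(1) A'(1) kop_Int_clop kop_def by blast
    moreover have "\<forall>s\<in>A \<inter> A'. g s + f s = 0" using A(3) A'(3) by simp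
    ultimately have "(\<lambda>s. g s + f s) \<in> G"
      unfolding G_def using C0_add[OF gC(1) f(1)] A(2) A'(2) by blast
    then have "\<phi> (\<lambda>s. g s + f s) \<le> Sup (\<phi> ` G)" by (rule cSUP_upper[OF _ bdd])
    then show ?thesis using dual_add[OF \<phi> gC(1) f(1)] g(2) by linarith
  qed
  have "\<bar>\<phi> f\<bar> \<le> \<epsilon>" if f: "f \<in> C" "\<And>s. \<bar>f s\<bar> \<le> indicator A s" "f t = 0" for f
  proof -
    \<comment> \<open>Since \<open>f\<close> is continuous and vanishes at \<open>t\<close>, it
      stays below \<open>\<delta>\<close> on some neighbourhood \<open>A'\<close>. That piece
      contributes at most \<open>K * \<delta>\<close>, hence at most half of
      \<open>\<epsilon>\<close>; the rest \<open>h\<close> vanishes near \<open>t\<close> and falls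
      under \<open>up\<close>.\<close>
    define \<delta> where "\<delta> = \<epsilon> / (2 * (K + 1))"
    have "0 < \<delta>" using \<open>0 < \<epsilon>\<close> K(1) unfolding \<delta>_def by simp
    have "openin X (- {s. \<delta> \<le> \<bar>f s\<bar>})"
      using closedin_abs_ge[OF C0_continuous[OF f(1)], of \<delta>]
      by (simp add: closedin_def Compl_eq_Diff_UNIV)
    then obtain A' where A': "kop A'" "t \<in> A'" "A' \<subseteq> - {s. \<delta> \<le> \<bar>f s\<bar>}"
      using kop_nbhd[of "- {s. \<delta> \<le> \<bar>f s\<bar>}" t] f(3) \<open>0 < \<delta>\<close> by auto
    define h where "h s = indicat_real (- A') s * f s" for s
    have clop: "clop A'" using A'(1) kop_def by simp
    have h: "h \<in> C" unfolding h_def using C0_restrict[OF f(1) clop_Compl[OF clop]] .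
    have hA: "\<bar>h s\<bar> \<le> indicator A s" for s
      using f(2)[of s] by (cases "s \<in> A'") (auto simp: h_def)
    have h0: "\<And>s. s \<in> A' \<Longrightarrow> h s = 0" by (simp add: h_def)
    have "\<phi> h \<le> \<epsilon> / 2" using up[OF h hA A'(1,2) h0] by blast
    moreover have "\<phi> (\<lambda>s. -1 * h s) \<le> \<epsilon> / 2"
      using hA h0 by (intro up[OF C0_scale[OF h] _ A'(1,2)]) auto
    then have "- \<phi> h \<le> \<epsilon> / 2" using dual_scale[OF \<phi> h, of "-1"] by simp
    moreover have "\<bar>\<phi> (\<lambda>s. indicat_real A' s * f s)\<bar> \<le> K * \<delta>"
      using A'(3) \<open>0 < \<delta>\<close> by (intro K(2) C0_restrict[OF f(1) clop]) (auto simp: indicator_def)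
    moreover have "K * \<delta> \<le> \<epsilon> / 2"
      using K(1) \<open>0 < \<epsilon>\<close> unfolding \<delta>_def by (simp add: field_simps)
    moreover have "\<phi> f = \<phi> (\<lambda>s. indicat_real A' s * f s) + \<phi> h"
      unfolding h_def using dual_split[OF \<phi> f(1) clop] .
    ultimately show ?thesis by linarith
  qed
  then show ?thesis using A by blast
qed

text \<open>The mass at \<open>t\<close> is the limit of \<open>\<phi>\<close> on indicators of
  neighbourhoods \<open>A n\<close>, and \<open>dual_punctured_nbhd\<close> makes these values
  Cauchy. A general \<open>f\<close> is compared with \<open>f t\<close> times the indicator, from
  which it differs by a function vanishing at \<open>t\<close>.\<close>

lemma dual_point_mass:
  assumes \<phi>: "\<phi> \<in> C0_dual le"
  shows "\<exists>a. \<forall>\<epsilon>>0. \<exists>A. kop A \<and> t \<in> A \<and>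
    (\<forall>f\<in>C. (\<forall>s. \<bar>f s\<bar> \<le> indicator A s) \<longrightarrow> \<bar>\<phi> f - a * f t\<bar> \<le> \<epsilon>)"
proof -
  have "\<forall>n. \<exists>A. kop A \<and> t \<in> A \<and>
    (\<forall>f\<in>C. (\<forall>s. \<bar>f s\<bar> \<le> indicator A s) \<longrightarrow> f t = 0 \<longrightarrow> \<bar>\<phi> f\<bar> \<le> 1 / real (Suc n))"
    using dual_punctured_nbhd[OF \<phi>] by simp
  then obtain A where A: "\<And>n. kop (A n)" "\<And>n. t \<in> A n"
    and small: "\<And>n f. f \<in> C \<Longrightarrow> (\<And>s. \<bar>f s\<bar> \<le> indicator (A n) s) \<Longrightarrow> f t = 0 \<Longrightarrow>
      \<bar>\<phi> f\<bar> \<le> 1 / real (Suc n)"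
    by metis
  define x where "x n = \<phi> (indicat_real (A n))" for n
  have inter: "\<bar>x n - \<phi> (indicat_real (A n \<inter> A m))\<bar> \<le> 1 / real (Suc n)" for n m
  proof -
    have "kop (A n \<inter> A m)" using A(1) kop_Int_clop kop_def by blast
    then have "x n - \<phi> (indicat_real (A n \<inter> A m)) =
        \<phi> (\<lambda>s. indicat_real (A n) s - indicat_real (A n \<inter> A m) s)"
      unfolding x_def using dual_diff[OF \<phi>] C0_indicator A(1) by simp
    moreover have "\<bar>\<phi> (\<lambda>s. indicat_real (A n) s - indicat_real (A n \<inter> A m) s)\<bar> \<le> 1 / real (Suc n)"
      using A(2) by (intro small C0_diff C0_indicator A(1) \<open>kop (A n \<inter> A m)\<close>) (auto simp: indicator_def)
    ultimately show ?thesis by simp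
  qed
  \<comment> \<open>The intervals of radius \<open>1 / real (Suc n)\<close> around
    \<open>x n\<close> meet pairwise, so the supremum of their left ends lies in all of them and
    serves as the limit.\<close>
  have cross: "x n - 1 / real (Suc n) \<le> x m + 1 / real (Suc m)" for n m
    using inter[of n m] inter[of m n] by (simp add: Int_commute)
  define a where "a = (SUP n. x n - 1 / real (Suc n))"
  have "bdd_above (range (\<lambda>n. x n - 1 / real (Suc n)))"
    using cross by (rule bdd_aboveI2[where M = "x 0 + 1 / real (Suc 0)"])
  then have "x n - 1 / real (Suc n) \<le> a" for n unfolding a_def by (intro cSUP_upper) auto
  moreover have "a \<le> x n + 1 / real (Suc n)" for n
    unfolding a_def using cross by (intro cSUP_least) auto
  ultimately have a: "\<bar>x n - a\<bar> \<le> 1 / real (Suc n)" for n by (smt (verit))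
  have main: "\<bar>\<phi> f - a * f t\<bar> \<le> 3 / real (Suc n)" if f: "f \<in> C" "\<And>s. \<bar>f s\<bar> \<le> indicator (A n) s" for f n
  proof -
    \<comment> \<open>The factor 1/2 compensates that the difference of two values in [-1, 1] can
      reach 2, so that \<open>small\<close> applies.\<close>
    define g where "g s = (1/2) * (f s - f t * indicat_real (A n) s)" for s
    have ft: "\<bar>f t\<bar> \<le> 1" using f(2)[of t] A(2) by simp
    have "g \<in> C" unfolding g_def by (intro C0_scale C0_diff f(1) C0_indicator A(1))
    moreover have "\<bar>g s\<bar> \<le> indicator (A n) s" for s
      using f(2)[of s] ft unfolding g_def by (cases "s \<in> A n") auto
    moreover have "g t = 0" unfolding g_def using A(2) by simp
    ultimately have "\<bar>\<phi> g\<bar> \<le> 1 / real (Suc n)" by (rule small)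
    moreover have "\<phi> g = (1/2) * (\<phi> f - f t * x n)"
    proof -
      have ind: "indicat_real (A n) \<in> C" by (rule C0_indicator[OF A(1)])
      have "\<phi> g = (1/2) * \<phi> (\<lambda>s. f s - f t * indicat_real (A n) s)"
        unfolding g_def by (intro dual_scale[OF \<phi>] C0_diff f(1) C0_scale ind)
      also have "\<phi> (\<lambda>s. f s - f t * indicat_real (A n) s) = \<phi> f - f t * x n"
        unfolding x_def dual_scale[OF \<phi> ind, symmetric] by (intro dual_diff[OF \<phi>] f(1) C0_scale ind)
      finally show ?thesis .
    qed
    ultimately have "\<bar>\<phi> f - f t * x n\<bar> \<le> 2 / real (Suc n)" by (simp add: abs_mult field_simps)
    moreover have "\<bar>f t * x n - a * f t\<bar> \<le> 1 / real (Suc n)"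
    proof -
      have "f t * x n - a * f t = f t * (x n - a)" by (simp add: algebra_simps)
      then have "\<bar>f t * x n - a * f t\<bar> \<le> 1 * \<bar>x n - a\<bar>"
        using ft by (simp add: abs_mult mult_left_le_one_le)
      then show ?thesis using a[of n] by simp
    qed
    moreover have "2 / real (Suc n) + 1 / real (Suc n) = 3 / real (Suc n)"
      by (simp add: add_divide_distrib[symmetric])
    ultimately show ?thesis by linarith
  qed
  have "\<exists>A. kop A \<and> t \<in> A \<and> (\<forall>f\<in>C. (\<forall>s. \<bar>f s\<bar> \<le> indicator A s) \<longrightarrow> \<bar>\<phi> f - a * f t\<bar> \<le> \<epsilon>)"
    if \<epsilon>: "0 < \<epsilon>" for \<epsilon>
  proof -
    obtain n where "inverse (real (Suc n)) < \<epsilon> / 3"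
      using reals_Archimedean[of "\<epsilon> / 3"] \<epsilon> by (metis zero_less_divide_iff zero_less_numeral)
    then have "3 / real (Suc n) \<le> \<epsilon>" by (simp add: field_simps)
    then have "\<forall>f\<in>C. (\<forall>s. \<bar>f s\<bar> \<le> indicator (A n) s) \<longrightarrow> \<bar>\<phi> f - a * f t\<bar> \<le> \<epsilon>"
      using main order_trans by blast
    then show ?thesis using A by blast
  qed
  then show ?thesis by blast
qed

text \<open>The second hypothesis says that \<open>a t\<close> is the point mass of
  \<open>\<phi>\<close> at \<open>t\<close>. The test function takes the value
  \<open>c t * sgn (a t)\<close> on small disjoint neighbourhoods of the points of \<open>T\<close>.
  With constant \<open>c\<close> this bounds the \<open>\<ell>\<^sub>1\<close> norm of
  \<open>a\<close>; with a weight as \<open>c\<close> it computes the dual of the new norm.\<close>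

lemma dual_lower_bound:
  assumes \<phi>: "\<phi> \<in> C0_dual le"
    and a: "\<And>t \<epsilon>. 0 < \<epsilon> \<Longrightarrow> \<exists>A. kop A \<and> t \<in> A \<and>
      (\<forall>f\<in>C. (\<forall>s. \<bar>f s\<bar> \<le> indicator A s) \<longrightarrow> \<bar>\<phi> f - a t * f t\<bar> \<le> \<epsilon>)"
    and T: "finite T" "\<And>t. t \<in> T \<Longrightarrow> openin X (O' t)" "\<And>t. t \<in> T \<Longrightarrow> t \<in> O' t"
    and c: "\<And>t. t \<in> T \<Longrightarrow> 0 \<le> c t" and "0 < \<epsilon>"
  shows "\<exists>f\<in>C. (\<forall>s. f s = 0 \<or> (\<exists>t\<in>T. s \<in> O' t \<and> \<bar>f s\<bar> \<le> c t)) \<and>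
    (\<Sum>t\<in>T. c t * \<bar>a t\<bar>) - \<epsilon> \<le> \<phi> f"
proof -
  \<comment> \<open>The errors at the points of \<open>T\<close> add up to
    \<open>sum c T * \<delta>\<close>; the summand 1 prevents division by zero.\<close>
  define \<delta> where "\<delta> = \<epsilon> / (1 + sum c T)"
  have "0 \<le> sum c T" using c by (simp add: sum_nonneg)
  then have \<delta>: "0 < \<delta>" "sum c T * \<delta> \<le> \<epsilon>"
    using \<open>0 < \<epsilon>\<close> unfolding \<delta>_def by (simp_all add: field_simps)
  have "\<forall>t. \<exists>A. kop A \<and> t \<in> A \<and>
      (\<forall>f\<in>C. (\<forall>s. \<bar>f s\<bar> \<le> indicator A s) \<longrightarrow> \<bar>\<phi> f - a t * f t\<bar> \<le> \<delta>)"
    using a[OF \<delta>(1)] by (rule allI)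
  from choice[OF this] obtain A where "\<forall>t. kop (A t) \<and> t \<in> A t \<and>
      (\<forall>f\<in>C. (\<forall>s. \<bar>f s\<bar> \<le> indicator (A t) s) \<longrightarrow> \<bar>\<phi> f - a t * f t\<bar> \<le> \<delta>)" by (elim exE)
  then have A: "\<And>t. kop (A t)" "\<And>t. t \<in> A t"
      "\<And>t f. f \<in> C \<Longrightarrow> (\<forall>s. \<bar>f s\<bar> \<le> indicator (A t) s) \<Longrightarrow> \<bar>\<phi> f - a t * f t\<bar> \<le> \<delta>"
    by simp_all
  have nb: "\<forall>t\<in>T. openin X (A t \<inter> O' t) \<and> t \<in> A t \<inter> O' t"
    using A(1,2) T(2,3) unfolding kop_def clop_def by auto
  obtain B where B: "\<And>t. t \<in> T \<Longrightarrow> kop (B t) \<and> t \<in> B t \<and> B t \<subseteq> A t \<inter> O' t"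
      and disj: "\<And>s t. s \<in> T \<Longrightarrow> t \<in> T \<Longrightarrow> s \<noteq> t \<Longrightarrow> B s \<inter> B t = {}"
    by (rule disjoint_kop_nbhds[OF T(1) nb]) blast
  define f where "f s = (\<Sum>t\<in>T. c t * sgn (a t) * indicat_real (B t) s)" for s
  have ind: "\<And>t. t \<in> T \<Longrightarrow> indicat_real (B t) \<in> C" using B C0_indicator by blast
  have "f \<in> C" unfolding f_def using T(1) ind by (rule C0_sum)
  have "\<phi> f = (\<Sum>t\<in>T. c t * sgn (a t) * \<phi> (indicat_real (B t)))"
    unfolding f_def using dual_sum[OF \<phi> T(1) ind] by simp
  also have "\<dots> \<ge> (\<Sum>t\<in>T. c t * (\<bar>a t\<bar> - \<delta>))"
  proof (rule sum_mono)
    fix t assume t: "t \<in> T"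
    have "\<bar>\<phi> (indicat_real (B t)) - a t * indicat_real (B t) t\<bar> \<le> \<delta>"
      using B[OF t] by (intro A(3) ind t) (auto simp: indicator_def)
    then have "\<bar>\<phi> (indicat_real (B t)) - a t\<bar> \<le> \<delta>" using B[OF t] by simp
    then have "\<bar>a t\<bar> - \<delta> \<le> sgn (a t) * \<phi> (indicat_real (B t))"
      using \<delta>(1) by (auto simp: sgn_if)
    then show "c t * (\<bar>a t\<bar> - \<delta>) \<le> c t * sgn (a t) * \<phi> (indicat_real (B t))"
      using mult_left_mono c[OF t] by (simp add: mult.assoc)
  qed
  finally have "(\<Sum>t\<in>T. c t * \<bar>a t\<bar>) - sum c T * \<delta> \<le> \<phi> f"
    by (simp add: right_diff_distrib sum_subtractf sum_distrib_right)
  moreover have "f s = 0 \<or> (\<exists>t\<in>T. s \<in> O' t \<and> \<bar>f s\<bar> \<le> c t)" for s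
  proof (cases "\<exists>t\<in>T. s \<in> B t")
    case True
    then obtain t where t: "t \<in> T" "s \<in> B t" by blast
    have "f s = (\<Sum>r\<in>T. if r = t then c t * sgn (a t) else 0)"
      unfolding f_def using disj[OF _ t(1)] t(2) by (intro sum.cong) (auto simp: indicator_def)
    then have "\<bar>f s\<bar> \<le> c t" using t(1) T(1) c[OF t(1)] by (simp add: abs_mult sgn_if)
    then show ?thesis using B[OF t(1)] t by blast
  next
    case False
    then show ?thesis unfolding f_def by simp
  qed
  ultimately show ?thesis using \<open>f \<in> C\<close> \<delta>(2) by (intro bexI[of _ f]) auto
qed

section \<open>Summable families as functionals\<close>

lemma summable_mult_bounded:
  fixes a f :: "'b \<Rightarrow> real"
  assumes "a summable_on UNIV" "\<And>t. \<bar>f t\<bar> \<le> M"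
  shows "(\<lambda>t. \<bar>a t * f t\<bar>) summable_on UNIV" "(\<lambda>t. a t * f t) summable_on UNIV"
    "\<bar>\<Sum>\<^sub>\<infinity>t. a t * f t\<bar> \<le> (\<Sum>\<^sub>\<infinity>t. \<bar>a t\<bar>) * M"
proof -
  have a: "(\<lambda>t. \<bar>a t\<bar>) summable_on UNIV"
    using assms(1) summable_on_iff_abs_summable_on_real[of a UNIV] by simp
  then have aM: "(\<lambda>t. \<bar>a t\<bar> * M) summable_on UNIV" by (rule summable_on_cmult_left)
  have le: "\<bar>a t * f t\<bar> \<le> \<bar>a t\<bar> * M" for t
    using assms(2) by (simp add: abs_mult mult_left_mono)
  show abs: "(\<lambda>t. \<bar>a t * f t\<bar>) summable_on UNIV"
    using aM by (rule summable_on_comparison_test) (use le in auto)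
  then show "(\<lambda>t. a t * f t) summable_on UNIV"
    using summable_on_iff_abs_summable_on_real[of "\<lambda>t. a t * f t" UNIV] by simp
  have "\<bar>\<Sum>\<^sub>\<infinity>t. a t * f t\<bar> \<le> (\<Sum>\<^sub>\<infinity>t. \<bar>a t * f t\<bar>)"
    using norm_infsum_bound[of "\<lambda>t. a t * f t" UNIV] abs by simp
  also have "\<dots> \<le> (\<Sum>\<^sub>\<infinity>t. \<bar>a t\<bar> * M)" using abs aM le by (rule infsum_mono)
  also have "\<dots> = (\<Sum>\<^sub>\<infinity>t. \<bar>a t\<bar>) * M" by (rule infsum_cmult_left')
  finally show "\<bar>\<Sum>\<^sub>\<infinity>t. a t * f t\<bar> \<le> (\<Sum>\<^sub>\<infinity>t. \<bar>a t\<bar>) * M" .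
qed

lemma sum_functional_dual:
  assumes "a summable_on UNIV"
  shows "(\<lambda>f. \<Sum>\<^sub>\<infinity>t. a t * f t) \<in> C0_dual le"
proof -
  have sum: "(\<lambda>t. a t * f t) summable_on UNIV" if "f \<in> C" for f
    using summable_mult_bounded(2)[OF assms, of f "supnorm f"] abs_le_supnorm[OF that] by simp
  have "(\<Sum>\<^sub>\<infinity>t. a t * (f t + g t)) = (\<Sum>\<^sub>\<infinity>t. a t * f t) + (\<Sum>\<^sub>\<infinity>t. a t * g t)" if "f \<in> C" "g \<in> C" for f g
    using infsum_add[OF sum[OF that(1)] sum[OF that(2)]] by (simp add: distrib_left)
  moreover have "(\<Sum>\<^sub>\<infinity>t. a t * (c * f t)) = c * (\<Sum>\<^sub>\<infinity>t. a t * f t)" for c f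
    using infsum_cmult_right'[of c "\<lambda>t. a t * f t" UNIV] by (simp add: mult_ac)
  moreover have "\<forall>f\<in>C. \<bar>\<Sum>\<^sub>\<infinity>t. a t * f t\<bar> \<le> (\<Sum>\<^sub>\<infinity>t. \<bar>a t\<bar>) * supnorm f"
    using summable_mult_bounded(3)[OF assms] abs_le_supnorm by blast
  ultimately show ?thesis unfolding C0_dual_def by blast
qed

lemma summable_tail:
  fixes a :: "'b \<Rightarrow> real"
  assumes "a summable_on UNIV" "0 < \<epsilon>"
  obtains F where "finite F" "(\<Sum>\<^sub>\<infinity>t\<in>-F. \<bar>a t\<bar>) \<le> \<epsilon>"
proof -
  have a: "(\<lambda>t. \<bar>a t\<bar>) summable_on UNIV"
    using assms(1) summable_on_iff_abs_summable_on_real[of a UNIV] by simp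
  then obtain F where F: "finite F" "dist (\<Sum>t\<in>F. \<bar>a t\<bar>) (\<Sum>\<^sub>\<infinity>t. \<bar>a t\<bar>) \<le> \<epsilon>"
    using infsum_finite_approximation[OF a assms(2)] by blast
  have "(\<Sum>\<^sub>\<infinity>t. \<bar>a t\<bar>) = (\<Sum>\<^sub>\<infinity>t\<in>F. \<bar>a t\<bar>) + (\<Sum>\<^sub>\<infinity>t\<in>-F. \<bar>a t\<bar>)"
    using infsum_Un_disjoint[of "\<lambda>t. \<bar>a t\<bar>" F "-F"] F(1) summable_on_subset[OF a, of "-F"] by simp
  then show thesis using that[of F] F by (simp add: dist_real_def)
qed

text \<open>Choose a finite \<open>F\<close> carrying all of the absolute mass up to
  \<open>\<epsilon>\<close>, and a neighbourhood of \<open>t\<close> avoiding the other points of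
  \<open>F\<close>. On functions supported there only the term at \<open>t\<close> and the tail
  remain.\<close>

lemma sum_functional_point_mass:
  fixes a :: "'a \<Rightarrow> real"
  assumes "a summable_on UNIV" "0 < \<epsilon>"
  shows "\<exists>A. kop A \<and> t \<in> A \<and>
    (\<forall>f. (\<forall>s. \<bar>f s\<bar> \<le> indicator A s) \<longrightarrow> \<bar>(\<Sum>\<^sub>\<infinity>s. a s * f s) - a t * f t\<bar> \<le> \<epsilon>)"
proof -
  obtain F where F: "finite F" "(\<Sum>\<^sub>\<infinity>t\<in>-F. \<bar>a t\<bar>) \<le> \<epsilon>"
    using summable_tail[OF assms] by blast
  obtain A where A: "kop A" "t \<in> A" "A \<subseteq> - (F - {t})"
    using kop_nbhd[of "- (F - {t})" t] openin_Compl_finite[of "F - {t}"] F(1) by auto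
  have "\<bar>(\<Sum>\<^sub>\<infinity>s. a s * f s) - a t * f t\<bar> \<le> \<epsilon>" if f: "\<forall>s. \<bar>f s\<bar> \<le> indicator A s" for f
  proof -
    have f1: "\<bar>f s\<bar> \<le> 1" for s using f[rule_format, of s] by (cases "s \<in> A") auto
    define h where "h s = (if s = t then 0 else f s)" for s
    have h1: "\<bar>h s\<bar> \<le> 1" for s unfolding h_def using f1 by simp
    have hF: "h s = 0" if "s \<in> F" for s
      using that A(3) f[rule_format, of s] unfolding h_def by (cases "s \<in> A") auto
    have "(\<Sum>\<^sub>\<infinity>s. a s * f s) = (\<Sum>\<^sub>\<infinity>s. a s * h s + (if s = t then a t * f t else 0))"
      by (intro infsum_cong) (simp add: h_def)
    also have "\<dots> = (\<Sum>\<^sub>\<infinity>s. a s * h s) + (\<Sum>\<^sub>\<infinity>s. if s = t then a t * f t else 0)"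
      by (rule infsum_add[OF summable_mult_bounded(2)[OF assms(1) h1]])
        (auto intro: finite_nonzero_values_imp_summable_on)
    also have "(\<Sum>\<^sub>\<infinity>s. if s = t then a t * f t else 0) = a t * f t"
      using infsum_cong_neutral[of UNIV "{t}" "\<lambda>s. if s = t then a t * f t else 0" "\<lambda>s. a t * f t"] by simp
    also have "(\<Sum>\<^sub>\<infinity>s. a s * h s) = (\<Sum>\<^sub>\<infinity>s\<in>-F. a s * h s)"
      using hF by (intro infsum_cong_neutral) auto
    finally have eq: "(\<Sum>\<^sub>\<infinity>s. a s * f s) - a t * f t = (\<Sum>\<^sub>\<infinity>s\<in>-F. a s * h s)" by simp
    have abs: "(\<lambda>s. \<bar>a s * h s\<bar>) summable_on -F"
      by (rule summable_on_subset[OF summable_mult_bounded(1)[OF assms(1) h1]]) simp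
    have a: "(\<lambda>s. \<bar>a s\<bar>) summable_on -F"
      using summable_on_subset[of "\<lambda>s. \<bar>a s\<bar>" UNIV "-F"] assms(1)
        summable_on_iff_abs_summable_on_real[of a UNIV] by simp
    have "\<bar>\<Sum>\<^sub>\<infinity>s\<in>-F. a s * h s\<bar> \<le> (\<Sum>\<^sub>\<infinity>s\<in>-F. \<bar>a s * h s\<bar>)"
      using norm_infsum_bound[of "\<lambda>s. a s * h s" "-F"] abs by simp
    also have "\<dots> \<le> (\<Sum>\<^sub>\<infinity>s\<in>-F. \<bar>a s\<bar>)"
      using h1 by (intro infsum_mono abs a) (simp add: abs_mult mult_left_le)
    finally show ?thesis using eq F(2) by simp
  qed
  then show ?thesis using A by blast
qed

text \<open>Along a branch, a functional without point masses has no first point at which it can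
  start to be nonzero; compactness of the sets \<open>{\<bar>f\<bar> \<ge> \<epsilon>}\<close> reduces the general case to
  finitely many branches.\<close>

lemma diffuse_dual_eq_zero:
  assumes \<phi>: "\<phi> \<in> C0_dual le"
    and small: "\<And>t \<epsilon>. 0 < \<epsilon> \<Longrightarrow> \<exists>A. kop A \<and> t \<in> A \<and>
      (\<forall>f\<in>C. (\<forall>s. \<bar>f s\<bar> \<le> indicator A s) \<longrightarrow> \<bar>\<phi> f\<bar> \<le> \<epsilon>)"
    and "f \<in> C"
  shows "\<phi> f = 0"
proof -
  have branch: "\<forall>f\<in>C. (\<forall>s. \<not> le s t \<longrightarrow> f s = 0) \<longrightarrow> \<phi> f = 0" for t
  proof (induction t rule: tree_induct)
    case (less t)
    show ?case
    proof (intro ballI impI)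
      fix f assume f: "f \<in> C" "\<forall>s. \<not> le s t \<longrightarrow> f s = 0"
      \<comment> \<open>The summand 1 keeps \<open>M\<close> positive even for \<open>f = 0\<close>,
        so that test functions can be rescaled by \<open>1 / M\<close>.\<close>
      define M where "M = 1 + supnorm f"
      have M: "\<bar>f s\<bar> \<le> M" "0 < M" for s
        using abs_le_supnorm[OF f(1), of s] unfolding M_def by linarith+
      have "\<bar>\<phi> f\<bar> \<le> \<epsilon>" if \<epsilon>: "0 < \<epsilon>" for \<epsilon>
      proof -
        obtain A where A: "kop A" "t \<in> A"
          "\<And>f. f \<in> C \<Longrightarrow> (\<forall>s. \<bar>f s\<bar> \<le> indicator A s) \<Longrightarrow> \<bar>\<phi> f\<bar> \<le> \<epsilon> / M"
          using small[of "\<epsilon> / M" t] \<epsilon> M(2) by auto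
        have bound: "\<bar>\<phi> g\<bar> \<le> \<epsilon>" if g: "g \<in> C" "\<And>s. \<bar>g s\<bar> \<le> M * indicator A s" for g
        proof -
          have "\<bar>(1 / M) * g s\<bar> \<le> indicator A s" for s
            using g(2)[of s] M(2) by (simp add: abs_mult field_simps)
          then have "\<bar>\<phi> (\<lambda>s. (1 / M) * g s)\<bar> \<le> \<epsilon> / M"
            by (intro A(3) C0_scale g(1)) blast
          then have "\<bar>\<phi> g\<bar> / M \<le> \<epsilon> / M"
            unfolding dual_scale[OF \<phi> g(1)] using M(2) by (simp add: abs_mult)
          then show ?thesis using M(2) by (simp add: divide_le_cancel)
        qed
        have "openin X A" using A(1) kop_def clop_def by blast
        then consider "dn t \<subseteq> A" | p where "lt p t" "dn t - dn p \<subseteq> A"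
          using nbhd_interval A(2) by blast
        then show ?thesis
        proof cases
          case 1
          then show ?thesis
            using f M by (intro bound) (auto simp: indicator_def)
        next
          case (2 p)
          have cl: "clop (dn p)" by (rule clop_dn)
          have "\<phi> (\<lambda>s. indicat_real (dn p) s * f s) = 0"
            using less[OF 2(1)] C0_restrict[OF f(1) cl] by (simp add: indicator_def)
          moreover have "\<bar>\<phi> (\<lambda>s. indicat_real (- dn p) s * f s)\<bar> \<le> \<epsilon>"
          proof (rule bound)
            show "(\<lambda>s. indicat_real (- dn p) s * f s) \<in> C"
              by (rule C0_restrict[OF f(1) clop_Compl[OF cl]])
            fix s
            show "\<bar>indicat_real (- dn p) s * f s\<bar> \<le> M * indicat_real A s"
            proof (cases "s \<in> A")
              case True
              then show ?thesis using M(1)[of s] M(2) by (simp add: indicator_def)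
            next
              case False
              then have "s \<in> dn p \<or> \<not> le s t" using 2(2) by blast
              then show ?thesis using f(2) False by (auto simp: indicator_def)
            qed
          qed
          ultimately show ?thesis using dual_split[OF \<phi> f(1) cl] by simp
        qed
      qed
      then show "\<phi> f = 0" by (metis abs_le_zero_iff field_le_epsilon add_0)
    qed
  qed
  have fin: "\<forall>f\<in>C. (\<forall>s. s \<notin> \<Union>(dn ` F) \<longrightarrow> f s = 0) \<longrightarrow> \<phi> f = 0" if "finite F" for F
    using that
  proof (induction F rule: finite_induct)
    case empty
    then show ?case using dual_zero[OF \<phi>] by (auto simp: fun_eq_iff[symmetric])
  next
    case (insert t F)
    show ?case
    proof (intro ballI impI)
      fix f assume f: "f \<in> C" "\<forall>s. s \<notin> \<Union>(dn ` insert t F) \<longrightarrow> f s = 0"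
      have "\<phi> (\<lambda>s. indicat_real (dn t) s * f s) = 0"
        by (rule branch[of t, rule_format, OF C0_restrict[OF f(1) clop_dn]]) simp
      moreover have "\<phi> (\<lambda>s. indicat_real (- dn t) s * f s) = 0"
        by (rule insert.IH[rule_format, OF C0_restrict[OF f(1) clop_Compl[OF clop_dn]]])
          (use f(2) in \<open>auto simp: indicator_def\<close>)
      ultimately show "\<phi> f = 0" using dual_split[OF \<phi> f(1) clop_dn[of t]] by simp
    qed
  qed
  obtain K where K: "0 \<le> K" "\<And>f M. f \<in> C \<Longrightarrow> (\<And>t. \<bar>f t\<bar> \<le> M) \<Longrightarrow> \<bar>\<phi> f\<bar> \<le> K * M"
    using dual_bound[OF \<phi>] by metis
  have clopU: "clop (\<Union>(dn ` F))" if "finite F" for F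
    unfolding clop_def using that openin_dn closedin_dn
    by (intro conjI openin_Union closedin_Union) auto
  have bd: "\<bar>\<phi> f\<bar> \<le> K * \<epsilon>" if \<epsilon>: "0 < \<epsilon>" for \<epsilon>
  proof -
    have "\<exists>\<F>. finite \<F> \<and> \<F> \<subseteq> range dn \<and> {t. \<epsilon> \<le> \<bar>f t\<bar>} \<subseteq> \<Union>\<F>"
      using le_refl openin_dn by (intro compactinD[OF C0_compact[OF \<open>f \<in> C\<close> \<epsilon>]]) auto
    then obtain \<F> where \<F>: "finite \<F>" "\<F> \<subseteq> range dn" "{t. \<epsilon> \<le> \<bar>f t\<bar>} \<subseteq> \<Union>\<F>"
      by (elim exE conjE)
    from finite_subset_image[OF \<F>(1,2)] obtain F where "finite F" "\<F> = dn ` F"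
      by (elim exE conjE)
    with \<F>(3) have F: "finite F" "{t. \<epsilon> \<le> \<bar>f t\<bar>} \<subseteq> \<Union>(dn ` F)" by simp_all
    have cl: "clop (\<Union>(dn ` F))" using clopU[OF F(1)] .
    have "\<phi> (\<lambda>s. indicat_real (\<Union>(dn ` F)) s * f s) = 0"
      using fin[OF F(1)] C0_restrict[OF \<open>f \<in> C\<close> cl] by (simp add: indicator_def)
    moreover have "\<bar>\<phi> (\<lambda>s. indicat_real (- \<Union>(dn ` F)) s * f s)\<bar> \<le> K * \<epsilon>"
    proof (intro K(2) C0_restrict \<open>f \<in> C\<close> clop_Compl cl)
      fix s
      show "\<bar>indicat_real (- \<Union>(dn ` F)) s * f s\<bar> \<le> \<epsilon>"
      proof (cases "s \<in> \<Union>(dn ` F)")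
        case False
        then have "\<not> \<epsilon> \<le> \<bar>f s\<bar>" using F(2) by blast
        then show ?thesis using \<epsilon> by (simp add: indicator_def)
      qed (use \<epsilon> in \<open>auto simp: indicator_def\<close>)
    qed
    ultimately show ?thesis using dual_split[OF \<phi> \<open>f \<in> C\<close> cl] by simp
  qed
  have "\<bar>\<phi> f\<bar> \<le> 0 + \<eta>" if \<eta>: "0 < \<eta>" for \<eta>
  proof -
    \<comment> \<open>Dividing by \<open>K + 1\<close> also covers the case
      \<open>K = 0\<close>.\<close>
    have "K * (\<eta> / (K + 1)) \<le> \<eta>" using K(1) \<eta> by (simp add: field_simps)
    moreover have "0 < \<eta> / (K + 1)" using K(1) \<eta> by simp
    ultimately show ?thesis using bd[of "\<eta> / (K + 1)"] by simp
  qed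
  then have "\<bar>\<phi> f\<bar> \<le> 0" by (rule field_le_epsilon)
  then show ?thesis by simp
qed

text \<open>The identification of the dual with \<open>\<ell>\<^sub>1\<close>. Sign patterns on
  finite sets show that the point masses are absolutely summable; subtracting the functional they
  define leaves \<open>\<psi>\<close>, which has no point masses and so vanishes on \<open>C\<close>
  by \<open>diffuse_dual_eq_zero\<close>.\<close>

theorem dual_representation:
  assumes \<phi>: "\<phi> \<in> C0_dual le"
  obtains a where "a summable_on UNIV" "\<And>f. f \<in> C \<Longrightarrow> \<phi> f = (\<Sum>\<^sub>\<infinity>t. a t * f t)"
proof -
  have "\<forall>t. \<exists>a. \<forall>\<epsilon>>0. \<exists>A. kop A \<and> t \<in> A \<and>
      (\<forall>f\<in>C. (\<forall>s. \<bar>f s\<bar> \<le> indicator A s) \<longrightarrow> \<bar>\<phi> f - a * f t\<bar> \<le> \<epsilon>)"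
    using dual_point_mass[OF \<phi>] by (rule allI)
  from choice[OF this] obtain a where "\<forall>t. \<forall>\<epsilon>>0. \<exists>A. kop A \<and> t \<in> A \<and>
      (\<forall>f\<in>C. (\<forall>s. \<bar>f s\<bar> \<le> indicator A s) \<longrightarrow> \<bar>\<phi> f - a t * f t\<bar> \<le> \<epsilon>)"
    by (elim exE)
  then have a: "\<And>t \<epsilon>. 0 < \<epsilon> \<Longrightarrow> \<exists>A. kop A \<and> t \<in> A \<and>
      (\<forall>f\<in>C. (\<forall>s. \<bar>f s\<bar> \<le> indicator A s) \<longrightarrow> \<bar>\<phi> f - a t * f t\<bar> \<le> \<epsilon>)"
    by simp
  obtain K where K: "0 \<le> K" "\<And>f M. f \<in> C \<Longrightarrow> (\<And>t. \<bar>f t\<bar> \<le> M) \<Longrightarrow> \<bar>\<phi> f\<bar> \<le> K * M"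
    using dual_bound[OF \<phi>] by metis
  have "(\<Sum>t\<in>T. \<bar>a t\<bar>) \<le> K" if T: "finite T" for T
  proof (rule field_le_epsilon)
    fix \<epsilon> :: real assume "0 < \<epsilon>"
    obtain f where f: "f \<in> C" "\<And>s. f s = 0 \<or> (\<exists>t\<in>T. s \<in> UNIV \<and> \<bar>f s\<bar> \<le> 1)"
        "(\<Sum>t\<in>T. 1 * \<bar>a t\<bar>) - \<epsilon> \<le> \<phi> f"
      using dual_lower_bound[OF \<phi> a T, of "\<lambda>_. UNIV" "\<lambda>_. 1" \<epsilon>] \<open>0 < \<epsilon>\<close>
        openin_topspace[of X] by auto
    have "\<bar>f s\<bar> \<le> 1" for s using f(2)[of s] by auto
    then show "(\<Sum>t\<in>T. \<bar>a t\<bar>) \<le> K + \<epsilon>" using K(2)[OF f(1), of 1] f(3) by simp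
  qed
  then have "(\<lambda>t. \<bar>a t\<bar>) summable_on UNIV"
    by (intro nonneg_bounded_partial_sums_imp_summable_on[where C = K]
        eventually_finite_subsets_at_top_weakI) auto
  then have sum: "a summable_on UNIV"
    using summable_on_iff_abs_summable_on_real[of a UNIV] by simp
  define \<psi> where "\<psi> f = \<phi> f - (\<Sum>\<^sub>\<infinity>t. a t * f t)" for f
  note S = sum_functional_dual[OF sum]
  have "\<psi> \<in> C0_dual le"
  proof -
    obtain K' where K': "\<And>f M. f \<in> C \<Longrightarrow> (\<And>t. \<bar>f t\<bar> \<le> M) \<Longrightarrow> \<bar>\<Sum>\<^sub>\<infinity>t. a t * f t\<bar> \<le> K' * M"
      using dual_bound[OF S] by metis
    have "\<forall>f\<in>C. \<bar>\<psi> f\<bar> \<le> (K + K') * supnorm f"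
    proof
      fix f assume "f \<in> C"
      from K(2)[OF this, of "supnorm f"] K'[OF this, of "supnorm f"] abs_le_supnorm[OF this]
      show "\<bar>\<psi> f\<bar> \<le> (K + K') * supnorm f" unfolding \<psi>_def by (simp add: distrib_right)
    qed
    moreover have "\<forall>f\<in>C. \<forall>g\<in>C. \<psi> (\<lambda>t. f t + g t) = \<psi> f + \<psi> g"
      unfolding \<psi>_def using dual_add[OF \<phi>] dual_add[OF S] by simp
    moreover have "\<forall>f\<in>C. \<forall>c. \<psi> (\<lambda>t. c * f t) = c * \<psi> f"
      unfolding \<psi>_def using dual_scale[OF \<phi>] dual_scale[OF S] by (simp add: right_diff_distrib)
    ultimately show ?thesis unfolding C0_dual_def by blast
  qed
  moreover have "\<exists>A. kop A \<and> t \<in> A \<and> (\<forall>f\<in>C. (\<forall>s. \<bar>f s\<bar> \<le> indicator A s) \<longrightarrow> \<bar>\<psi> f\<bar> \<le> \<epsilon>)"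
    if \<epsilon>: "0 < \<epsilon>" for t \<epsilon>
  proof -
    obtain A where A: "kop A" "t \<in> A"
        "\<And>f. f \<in> C \<Longrightarrow> (\<forall>s. \<bar>f s\<bar> \<le> indicator A s) \<Longrightarrow> \<bar>\<phi> f - a t * f t\<bar> \<le> \<epsilon> / 2"
      using a[of "\<epsilon> / 2" t] \<epsilon> by auto
    obtain B where B: "kop B" "t \<in> B"
        "\<And>f. (\<forall>s. \<bar>f s\<bar> \<le> indicator B s) \<Longrightarrow> \<bar>(\<Sum>\<^sub>\<infinity>s. a s * f s) - a t * f t\<bar> \<le> \<epsilon> / 2"
      using sum_functional_point_mass[OF sum, of "\<epsilon> / 2" t] \<epsilon> by auto
    have "\<bar>\<psi> f\<bar> \<le> \<epsilon>" if f: "f \<in> C" "\<forall>s. \<bar>f s\<bar> \<le> indicator (A \<inter> B) s" for f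
    proof -
      have "\<bar>f s\<bar> \<le> indicator A s" "\<bar>f s\<bar> \<le> indicator B s" for s
        using f(2)[rule_format, of s] by (cases "s \<in> A"; cases "s \<in> B"; simp)+
      then show ?thesis using A(3)[OF f(1)] B(3)[of f] unfolding \<psi>_def by (smt (verit) field_sum_of_halves)
    qed
    moreover have "kop (A \<inter> B)" using A(1) B(1) kop_Int_clop kop_def by blast
    ultimately show ?thesis using A(2) B(2) by blast
  qed
  ultimately have "\<psi> f = 0" if "f \<in> C" for f by (rule diffuse_dual_eq_zero) (assumption | rule that)+
  then show thesis using that[OF sum] unfolding \<psi>_def by simp
qed

end

section \<open>Norms from families of disjoint open sets\<close>

text \<open>The whole space at level 0 has weight 1 everywhere. It bounds the new norm by the sup
  norm, and its dual coordinate, the total variation, later excludes cancellation between two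
  functionals.\<close>

locale open_families = hausdorff_tree +
  fixes Us :: "nat \<Rightarrow> 'a set set"
  assumes Us_0: "Us 0 = {UNIV}"
    and Us_open: "U \<in> Us n \<Longrightarrow> openin X U"
    and Us_disjoint: "U \<in> Us n \<Longrightarrow> V \<in> Us n \<Longrightarrow> U \<noteq> V \<Longrightarrow> U \<inter> V = {}"
begin

definition wt :: "nat \<times> 'a set \<Rightarrow> 'a \<Rightarrow> real" where
  "wt i t = (1/2) ^ fst i * indicator (snd i) t"

abbreviation Ix :: "(nat \<times> 'a set) set" where
  "Ix \<equiv> Sigma UNIV Us"

text \<open>The unit ball of the new norm consists of the functions dominated by a weight
  \<open>\<Sum>i. b i * wt i\<close> with \<open>b\<close> in the unit ball of \<open>\<ell>\<^sub>2\<close>; as these weights are lower semicontinuous,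
  the dual norm of a measure \<open>a\<close> is the \<open>\<ell>\<^sub>2\<close> norm of the family \<open>mass a\<close>.\<close>

definition dominates :: "(nat \<times> 'a set) set \<Rightarrow> (nat \<times> 'a set \<Rightarrow> real) \<Rightarrow> ('a \<Rightarrow> real) \<Rightarrow> bool" where
  "dominates S b f \<longleftrightarrow> finite S \<and> S \<subseteq> Ix \<and> (\<forall>i\<in>S. 0 \<le> b i) \<and>
     (\<forall>t. \<bar>f t\<bar> \<le> (\<Sum>i\<in>S. b i * wt i t))"

text \<open>A gauge. Its infimum is not claimed to be attained, so later arguments take almost
  optimal coefficients from \<open>nrm_approx\<close>.\<close>

definition nrm :: "('a \<Rightarrow> real) \<Rightarrow> real" where
  "nrm f = Inf {L2_set b S | S b. dominates S b f}"

text \<open>For \<open>U\<close> in \<open>Us n\<close>, the coordinate at \<open>(n, U)\<close> is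
  the variation of \<open>a\<close> on \<open>U\<close>, scaled by \<open>(1/2) ^ n\<close>; see
  \<open>mass_eq\<close>.\<close>

definition mass :: "('a \<Rightarrow> real) \<Rightarrow> nat \<times> 'a set \<Rightarrow> real" where
  "mass a i = (\<Sum>\<^sub>\<infinity>t. \<bar>a t\<bar> * wt i t)"

section \<open>Equivalence of the new norm with the sup norm\<close>

lemma wt_nonneg: "0 \<le> wt i t"
  by (simp add: wt_def)

lemma wt_le_1: "wt i t \<le> 1"
  unfolding wt_def by (simp add: indicator_def power_le_one)

text \<open>By disjointness each level has at most one set containing \<open>t\<close>, so the sum
  is part of a geometric series.\<close>

lemma sum_wt_le:
  assumes "finite S" "S \<subseteq> Ix"
  shows "(\<Sum>i\<in>S. wt i t) \<le> 2"
proof -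
  define S' where "S' = {i \<in> S. t \<in> snd i}"
  have "inj_on fst S'"
  proof (rule inj_onI)
    fix i j assume ij: "i \<in> S'" "j \<in> S'" "fst i = fst j"
    obtain m U n V where eq: "i = (m, U)" "j = (n, V)" by (cases i; cases j)
    then have "U \<in> Us n" "V \<in> Us n" "t \<in> U" "t \<in> V"
      using ij assms(2) unfolding S'_def by auto
    then show "i = j" using Us_disjoint[of U n V] eq ij(3) by auto
  qed
  have "(\<Sum>i\<in>S. wt i t) = (\<Sum>i\<in>S'. (1/2) ^ fst i)"
    unfolding S'_def wt_def using assms(1) by (intro sum.mono_neutral_cong_right) (auto simp: indicator_def)
  also have "\<dots> = (\<Sum>n\<in>fst ` S'. (1/2) ^ n)"
    using sum.reindex[OF \<open>inj_on fst S'\<close>, of "\<lambda>n. (1/2 :: real) ^ n"] by simp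
  also have "\<dots> \<le> (\<Sum>n. (1/2 :: real) ^ n)"
    using assms(1) by (intro sum_le_suminf summable_geometric) (auto simp: S'_def)
  also have "\<dots> = 2" by (simp add: suminf_geometric)
  finally show ?thesis .
qed

text \<open>Each coefficient is at most the norm of \<open>b\<close>, and the weights add up to at
  most 2. This gives the lower estimate in the equivalence of norms.\<close>

lemma dominates_le:
  assumes "dominates S b f"
  shows "\<bar>f t\<bar> \<le> 2 * L2_set b S"
proof -
  have fin: "finite S" and "S \<subseteq> Ix" using assms unfolding dominates_def by auto
  have "\<bar>f t\<bar> \<le> (\<Sum>i\<in>S. b i * wt i t)" using assms unfolding dominates_def by blast
  also have "\<dots> \<le> (\<Sum>i\<in>S. L2_set b S * wt i t)"
    by (intro sum_mono mult_right_mono member_le_L2_set fin wt_nonneg)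
  also have "\<dots> = L2_set b S * (\<Sum>i\<in>S. wt i t)" by (simp add: sum_distrib_left)
  also have "\<dots> \<le> L2_set b S * 2"
    by (intro mult_left_mono sum_wt_le fin \<open>S \<subseteq> Ix\<close>) simp
  finally show ?thesis by simp
qed

lemma dominates_const:
  assumes "\<And>t. \<bar>f t\<bar> \<le> M"
  shows "dominates {(0, UNIV)} (\<lambda>_. M) f" "L2_set (\<lambda>_. M) {(0, UNIV)} = M"
proof -
  have "0 \<le> M" using assms[of undefined] by linarith
  then show "dominates {(0, UNIV)} (\<lambda>_. M) f" "L2_set (\<lambda>_. M) {(0, UNIV)} = M"
    unfolding dominates_def using assms Us_0 by (auto simp: wt_def)
qed

lemma nrm_le: "dominates S b f \<Longrightarrow> nrm f \<le> L2_set b S"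
  unfolding nrm_def by (intro cInf_lower bdd_belowI[of _ 0]) auto

lemma nrm_greatest:
  assumes "f \<in> C" "\<And>S b. dominates S b f \<Longrightarrow> c \<le> L2_set b S"
  shows "c \<le> nrm f"
  unfolding nrm_def
proof (rule cInf_greatest)
  show "{L2_set b S | S b. dominates S b f} \<noteq> {}"
    using dominates_const(1)[of f "supnorm f"] abs_le_supnorm[OF assms(1)] by blast
qed (use assms(2) in auto)

lemma nrm_nonneg: "f \<in> C \<Longrightarrow> 0 \<le> nrm f"
  by (rule nrm_greatest) auto

lemma nrm_approx:
  assumes "f \<in> C" "nrm f < c"
  obtains S b where "dominates S b f" "L2_set b S < c"
proof -
  have "\<exists>S b. dominates S b f \<and> L2_set b S < c"
    using nrm_greatest[OF assms(1), of c] assms(2) by (meson not_le)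
  then show thesis using that by (elim exE conjE)
qed

lemma nrm_le_supnorm:
  assumes "f \<in> C"
  shows "nrm f \<le> supnorm f"
  using nrm_le[OF dominates_const(1)[of f "supnorm f"]] dominates_const(2)[of f "supnorm f"]
    abs_le_supnorm[OF assms] by simp

lemma abs_le_nrm:
  assumes "f \<in> C"
  shows "\<bar>f t\<bar> \<le> 2 * nrm f"
proof -
  have "\<bar>f t\<bar> / 2 \<le> nrm f"
  proof (rule nrm_greatest[OF assms])
    fix S b assume "dominates S b f"
    then show "\<bar>f t\<bar> / 2 \<le> L2_set b S" using dominates_le[of S b f t] by simp
  qed
  then show ?thesis by simp
qed

lemma L2_set_extend:
  assumes "finite S" "S' \<subseteq> S"
  shows "L2_set (\<lambda>i. if i \<in> S' then b i else 0) S = L2_set b S'"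
  unfolding L2_set_def using assms by (intro arg_cong[of _ _ sqrt] sum.mono_neutral_cong_right) auto

lemma sum_extend:
  fixes h :: "'b \<Rightarrow> real"
  assumes "finite S" "S' \<subseteq> S"
  shows "(\<Sum>i\<in>S. (if i \<in> S' then b i else 0) * h i) = (\<Sum>i\<in>S'. b i * h i)"
  using assms by (intro sum.mono_neutral_cong_right) auto

text \<open>Almost optimal coefficients for \<open>f\<close> and \<open>g\<close> are padded by
  zeros to a common index set and added; the rest is Minkowski's inequality.\<close>

lemma nrm_triangle:
  assumes "f \<in> C" "g \<in> C"
  shows "nrm (\<lambda>t. f t + g t) \<le> nrm f + nrm g"
proof (rule field_le_epsilon)
  fix \<epsilon> :: real assume "0 < \<epsilon>"
  then have lt: "nrm f < nrm f + \<epsilon> / 2" "nrm g < nrm g + \<epsilon> / 2" by simp_all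
  obtain S b where S: "dominates S b f" "L2_set b S < nrm f + \<epsilon> / 2"
    using nrm_approx[OF assms(1) lt(1)] .
  obtain S' b' where S': "dominates S' b' g" "L2_set b' S' < nrm g + \<epsilon> / 2"
    using nrm_approx[OF assms(2) lt(2)] .
  define B where "B i = (if i \<in> S then b i else 0)" for i
  define B' where "B' i = (if i \<in> S' then b' i else 0)" for i
  have fin: "finite (S \<union> S')" using S(1) S'(1) unfolding dominates_def by simp
  have "dominates (S \<union> S') (\<lambda>i. B i + B' i) (\<lambda>t. f t + g t)"
    unfolding dominates_def
  proof (intro conjI allI ballI)
    show "finite (S \<union> S')" by (rule fin)
    show "S \<union> S' \<subseteq> Ix" using S(1) S'(1) unfolding dominates_def by simp
    show "0 \<le> B i + B' i" for i
      using S(1) S'(1) unfolding dominates_def B_def B'_def by simp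
    fix t
    have "\<bar>f t + g t\<bar> \<le> \<bar>f t\<bar> + \<bar>g t\<bar>" by (rule abs_triangle_ineq)
    also have "\<dots> \<le> (\<Sum>i\<in>S. b i * wt i t) + (\<Sum>i\<in>S'. b' i * wt i t)"
      using S(1) S'(1) unfolding dominates_def by (intro add_mono) auto
    also have "\<dots> = (\<Sum>i\<in>S \<union> S'. (B i + B' i) * wt i t)"
      unfolding distrib_right sum.distrib B_def B'_def
      using sum_extend[OF fin, of S b "\<lambda>i. wt i t"] sum_extend[OF fin, of S' b' "\<lambda>i. wt i t"] by simp
    finally show "\<bar>f t + g t\<bar> \<le> (\<Sum>i\<in>S \<union> S'. (B i + B' i) * wt i t)" .
  qed
  then have "nrm (\<lambda>t. f t + g t) \<le> L2_set (\<lambda>i. B i + B' i) (S \<union> S')" by (rule nrm_le)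
  also have "\<dots> \<le> L2_set B (S \<union> S') + L2_set B' (S \<union> S')" by (rule L2_set_triangle_ineq)
  also have "\<dots> = L2_set b S + L2_set b' S'"
    unfolding B_def B'_def using L2_set_extend[OF fin, of S b] L2_set_extend[OF fin, of S' b'] by simp
  finally show "nrm (\<lambda>t. f t + g t) \<le> nrm f + nrm g + \<epsilon>" using S(2) S'(2) by simp
qed

lemma nrm_scale_le:
  assumes "f \<in> C"
  shows "nrm (\<lambda>t. c * f t) \<le> \<bar>c\<bar> * nrm f"
proof (cases "c = 0")
  case True
  then show ?thesis using nrm_le[OF dominates_const(1)[of "\<lambda>t. c * f t" 0]]
      dominates_const(2)[of "\<lambda>t. c * f t" 0] by simp
next
  case False
  have "nrm (\<lambda>t. c * f t) / \<bar>c\<bar> \<le> nrm f"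
  proof (rule nrm_greatest[OF assms])
    fix S b assume S: "dominates S b f"
    have "dominates S (\<lambda>i. \<bar>c\<bar> * b i) (\<lambda>t. c * f t)"
      using S unfolding dominates_def
      by (auto simp: abs_mult mult.assoc sum_distrib_left[symmetric] intro: mult_left_mono)
    then have "nrm (\<lambda>t. c * f t) \<le> L2_set (\<lambda>i. \<bar>c\<bar> * b i) S" by (rule nrm_le)
    also have "\<dots> = \<bar>c\<bar> * L2_set b S" by (simp add: L2_set_right_distrib)
    finally show "nrm (\<lambda>t. c * f t) / \<bar>c\<bar> \<le> L2_set b S"
      using False by (simp add: field_simps)
  qed
  then show ?thesis using False by (simp add: field_simps)
qed

lemma nrm_scale:
  assumes "f \<in> C"
  shows "nrm (\<lambda>t. c * f t) = \<bar>c\<bar> * nrm f"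
proof (rule antisym[OF nrm_scale_le[OF assms]])
  show "\<bar>c\<bar> * nrm f \<le> nrm (\<lambda>t. c * f t)"
  proof (cases "c = 0")
    case True
    then show ?thesis using nrm_nonneg[OF C0_zero] by simp
  next
    case False
    have "nrm (\<lambda>t. (1 / c) * (c * f t)) \<le> \<bar>1 / c\<bar> * nrm (\<lambda>t. c * f t)"
      by (rule nrm_scale_le[OF C0_scale[OF assms]])
    then show ?thesis using False by (simp add: field_simps)
  qed
qed

lemma equivalent_nrm: "equivalent_norm le nrm"
  unfolding equivalent_norm_def
proof (intro conjI ballI allI)
  fix f assume f: "f \<in> C"
  show "nrm f = 0 \<longleftrightarrow> f = (\<lambda>t. 0)"
  proof
    assume "nrm f = 0"
    then have "f t = 0" for t using abs_le_nrm[OF f, of t] by simp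
    then show "f = (\<lambda>t. 0)" by auto
  next
    assume "f = (\<lambda>t. 0)"
    then show "nrm f = 0" using nrm_scale[OF f, of 0] by simp
  qed
next
  have "1 / 2 * supnorm f \<le> nrm f \<and> nrm f \<le> 1 * supnorm f" if "f \<in> C" for f
    using supnorm_le[of f "2 * nrm f"] abs_le_nrm[OF that] nrm_le_supnorm[OF that] by simp
  then show "\<exists>a b. 0 < a \<and> 0 < b \<and> (\<forall>f\<in>C. a * supnorm f \<le> nrm f \<and> nrm f \<le> b * supnorm f)"
    by (intro exI[of _ "1/2"] exI[of _ 1]) simp
qed (simp_all add: nrm_scale nrm_triangle)

section \<open>Pairing dominated functions with summable families\<close>

lemma mass_summable:
  assumes "a summable_on UNIV"
  shows "(\<lambda>t. \<bar>a t\<bar> * wt i t) summable_on UNIV"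
proof -
  have "(\<lambda>t. \<bar>a t * wt i t\<bar>) summable_on UNIV"
    using wt_nonneg wt_le_1 by (intro summable_mult_bounded(1)[OF assms, where M = 1]) simp
  then show ?thesis using wt_nonneg by (simp add: abs_mult)
qed

lemma mass_nonneg: "0 \<le> mass a i"
  unfolding mass_def by (intro infsum_nonneg) (simp add: wt_nonneg)

lemma mass_sum:
  assumes "a summable_on UNIV" "finite S"
  shows "((\<lambda>t. (\<Sum>i\<in>S. b i * wt i t) * \<bar>a t\<bar>) has_sum (\<Sum>i\<in>S. b i * mass a i)) UNIV"
  using assms(2)
proof (induction S rule: finite_induct)
  case empty
  then show ?case by simp
next
  case (insert i S)
  have "((\<lambda>t. \<bar>a t\<bar> * wt i t) has_sum mass a i) UNIV"
    unfolding mass_def by (rule has_sum_infsum[OF mass_summable[OF assms(1)]])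
  then have "((\<lambda>t. b i * (\<bar>a t\<bar> * wt i t)) has_sum b i * mass a i) UNIV"
    by (rule has_sum_cmult_right)
  from has_sum_add[OF this insert.IH] show ?case
    using insert.hyps by (simp add: algebra_simps)
qed

text \<open>Sum the majorant of \<open>f\<close> against \<open>\<bar>a t\<bar>\<close>, then apply
  the Cauchy-Schwarz inequality.\<close>

lemma pairing_le:
  assumes a: "a summable_on UNIV" and f: "f \<in> C" and S: "dominates S b f"
  shows "\<bar>\<Sum>\<^sub>\<infinity>t. a t * f t\<bar> \<le> L2_set b S * L2_set (mass a) S"
proof -
  have fin: "finite S" and b: "\<And>i. i \<in> S \<Longrightarrow> 0 \<le> b i"
    and le: "\<And>t. \<bar>f t\<bar> \<le> (\<Sum>i\<in>S. b i * wt i t)"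
    using S unfolding dominates_def by auto
  note abs = summable_mult_bounded(1)[OF a abs_le_supnorm[OF f]]
  have "\<bar>\<Sum>\<^sub>\<infinity>t. a t * f t\<bar> \<le> (\<Sum>\<^sub>\<infinity>t. \<bar>a t * f t\<bar>)"
    using norm_infsum_bound[of "\<lambda>t. a t * f t" UNIV] abs by simp
  also have "\<dots> \<le> (\<Sum>i\<in>S. b i * mass a i)"
  proof (rule has_sum_mono[OF has_sum_infsum[OF abs] mass_sum[OF a fin]])
    show "\<bar>a t * f t\<bar> \<le> (\<Sum>i\<in>S. b i * wt i t) * \<bar>a t\<bar>" for t
      using mult_right_mono[OF le[of t], of "\<bar>a t\<bar>"] by (simp add: abs_mult mult.commute)
  qed
  also have "\<dots> = (\<Sum>i\<in>S. \<bar>b i\<bar> * \<bar>mass a i\<bar>)"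
    using b mass_nonneg by (intro sum.cong) auto
  also have "\<dots> \<le> L2_set b S * L2_set (mass a) S" by (rule L2_set_mult_ineq)
  finally show ?thesis .
qed

section \<open>The dual norm as an \<open>\<ell>\<^sub>2\<close> norm\<close>

context
  fixes \<phi> a
  assumes \<phi>: "\<phi> \<in> C0_dual le" and a: "a summable_on UNIV"
    and rep: "\<And>f. f \<in> C \<Longrightarrow> \<phi> f = (\<Sum>\<^sub>\<infinity>t. a t * f t)"
begin

lemma dual_nrm_upper:
  assumes "f \<in> C" "nrm f \<le> 1"
  shows "\<bar>\<phi> f\<bar> \<le> dual_norm le nrm \<phi>"
  unfolding dual_norm_def
proof (rule cSUP_upper)
  show "bdd_above ((\<lambda>f. \<bar>\<phi> f\<bar>) ` {f \<in> C. nrm f \<le> 1})"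
  proof -
    obtain K where K: "\<And>f M. f \<in> C \<Longrightarrow> (\<And>t. \<bar>f t\<bar> \<le> M) \<Longrightarrow> \<bar>\<phi> f\<bar> \<le> K * M"
      using dual_bound[OF \<phi>] by metis
    have "\<bar>\<phi> f\<bar> \<le> K * 2" if "f \<in> C" "nrm f \<le> 1" for f
    proof (rule K[OF that(1)])
      show "\<bar>f t\<bar> \<le> 2" for t using abs_le_nrm[OF that(1), of t] that(2) by simp
    qed
    then show ?thesis by (intro bdd_aboveI2[where M = "K * 2"]) simp
  qed
qed (use assms in simp)

lemma dual_nrm_nonneg: "0 \<le> dual_norm le nrm \<phi>"
  using dual_nrm_upper[OF C0_zero] nrm_scale[OF C0_zero, of 0] by simp

text \<open>The upper half of the formula for the dual norm, by \<open>pairing_le\<close> with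
  almost optimal coefficients.\<close>

lemma dual_nrm_least:
  assumes Q: "\<And>S. finite S \<Longrightarrow> S \<subseteq> Ix \<Longrightarrow> L2_set (mass a) S \<le> Q"
  shows "dual_norm le nrm \<phi> \<le> Q"
  unfolding dual_norm_def
proof (rule cSUP_least)
  show "{f \<in> C. nrm f \<le> 1} \<noteq> {}"
    using C0_zero nrm_scale[OF C0_zero, of 0] by force
next
  fix f assume "f \<in> {f \<in> C. nrm f \<le> 1}"
  then have f: "f \<in> C" "nrm f \<le> 1" by auto
  have "0 \<le> Q" using Q[of "{}"] by simp
  show "\<bar>\<phi> f\<bar> \<le> Q"
  proof (rule field_le_epsilon)
    fix \<epsilon> :: real assume "0 < \<epsilon>"
    define \<delta> where "\<delta> = \<epsilon> / (Q + 1)"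
    have \<delta>: "0 < \<delta>" "\<delta> * Q \<le> \<epsilon>"
      using \<open>0 < \<epsilon>\<close> \<open>0 \<le> Q\<close> unfolding \<delta>_def by (simp_all add: field_simps)
    then have "nrm f < 1 + \<delta>" using f(2) by simp
    then obtain S b where S: "dominates S b f" "L2_set b S < 1 + \<delta>"
      by (rule nrm_approx[OF f(1)])
    have "\<bar>\<phi> f\<bar> \<le> L2_set b S * L2_set (mass a) S"
      using pairing_le[OF a f(1) S(1)] rep[OF f(1)] by simp
    also have "\<dots> \<le> (1 + \<delta>) * Q"
      using S Q[of S] \<delta>(1) unfolding dominates_def by (intro mult_mono) auto
    also have "\<dots> \<le> Q + \<epsilon>" using \<delta>(2) by (simp add: distrib_right)
    finally show "\<bar>\<phi> f\<bar> \<le> Q + \<epsilon>" .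
  qed
qed

text \<open>The lower half. Equality in Cauchy-Schwarz dictates coefficients \<open>b\<close>
  proportional to \<open>mass a\<close>. The resulting weight \<open>c\<close> is lower
  semicontinuous, so \<open>dual_lower_bound\<close> supplies functions below \<open>c\<close> whose
  pairing with \<open>a\<close> nearly reaches the sum of \<open>c t * \<bar>a t\<bar>\<close>,
  which is \<open>s\<close>.\<close>

lemma mass_le_dual_nrm:
  assumes S: "finite S" "S \<subseteq> Ix"
  shows "L2_set (mass a) S \<le> dual_norm le nrm \<phi>"
proof (cases "L2_set (mass a) S = 0")
  case True
  then show ?thesis using dual_nrm_nonneg by simp
next
  case False
  define s where "s = L2_set (mass a) S"
  have s: "0 < s" using False L2_set_nonneg[of "mass a" S] unfolding s_def by linarith
  define b where "b i = (1 / s) * mass a i" for i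
  have b: "0 \<le> b i" for i using mass_nonneg s unfolding b_def by simp
  have b1: "L2_set b S = 1"
    unfolding b_def using L2_set_right_distrib[of "1 / s" "mass a" S] s by (simp add: s_def)
  define c where "c t = (\<Sum>i\<in>S. b i * wt i t)" for t
  have c: "0 \<le> c t" for t unfolding c_def by (intro sum_nonneg mult_nonneg_nonneg b wt_nonneg)
  \<comment> \<open>On the intersection of all sets of \<open>S\<close> that contain
    \<open>t\<close>, no weight present at \<open>t\<close> is lost, hence \<open>c\<close> is at
    least \<open>c t\<close> there. This is the lower semicontinuity of \<open>c\<close>.\<close>
  define O' where "O' t = \<Inter>(insert UNIV (snd ` {i \<in> S. t \<in> snd i}))" for t
  have "openin X (O' t)" for t
  proof -
    have "openin X UNIV" using openin_topspace[of X] by simp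
    moreover have "openin X (snd i)" if "i \<in> S" for i
      using that S(2) Us_open[of "snd i" "fst i"] by (cases i) auto
    ultimately show ?thesis unfolding O'_def using S(1) by (intro openin_Inter) auto
  qed
  moreover have "t \<in> O' t" for t unfolding O'_def by auto
  ultimately have nb: "\<And>t. openin X (O' t)" "\<And>t. t \<in> O' t" .
  have mono: "c t \<le> c r" if "r \<in> O' t" for r t
    unfolding c_def using that b unfolding O'_def wt_def
    by (intro sum_mono mult_left_mono) (auto simp: indicator_def)
  have loc: "\<exists>A. kop A \<and> t \<in> A \<and> (\<forall>f\<in>C. (\<forall>s. \<bar>f s\<bar> \<le> indicator A s) \<longrightarrow> \<bar>\<phi> f - a t * f t\<bar> \<le> \<epsilon>)"
    if "0 < \<epsilon>" for t \<epsilon>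
  proof -
    from sum_functional_point_mass[OF a that, of t] obtain A where A: "kop A" "t \<in> A"
      "\<forall>f. (\<forall>s. \<bar>f s\<bar> \<le> indicator A s) \<longrightarrow> \<bar>(\<Sum>\<^sub>\<infinity>s. a s * f s) - a t * f t\<bar> \<le> \<epsilon>"
      by (elim exE conjE)
    then show ?thesis using rep by (intro exI[of _ A]) simp
  qed
  have fin: "(\<Sum>t\<in>T. c t * \<bar>a t\<bar>) \<le> dual_norm le nrm \<phi>" if "finite T" for T
  proof (rule field_le_epsilon)
    fix \<epsilon> :: real assume "0 < \<epsilon>"
    have "\<exists>f\<in>C. (\<forall>s. f s = 0 \<or> (\<exists>t\<in>T. s \<in> O' t \<and> \<bar>f s\<bar> \<le> c t)) \<and>
        (\<Sum>t\<in>T. c t * \<bar>a t\<bar>) - \<epsilon> \<le> \<phi> f"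
      by (rule dual_lower_bound[OF \<phi> loc \<open>finite T\<close> nb c \<open>0 < \<epsilon>\<close>])
    then obtain f where f: "f \<in> C" "\<forall>s. f s = 0 \<or> (\<exists>t\<in>T. s \<in> O' t \<and> \<bar>f s\<bar> \<le> c t)"
        "(\<Sum>t\<in>T. c t * \<bar>a t\<bar>) - \<epsilon> \<le> \<phi> f" by (elim bexE conjE)
    have "\<bar>f r\<bar> \<le> c r" for r
      using f(2)[rule_format, of r] c[of r] mono[of r] by (auto intro: order_trans)
    then have "dominates S b f" unfolding dominates_def c_def using S b by simp
    then have "nrm f \<le> 1" using nrm_le b1 by metis
    then have "\<phi> f \<le> dual_norm le nrm \<phi>" using dual_nrm_upper[OF f(1)] by simp
    then show "(\<Sum>t\<in>T. c t * \<bar>a t\<bar>) \<le> dual_norm le nrm \<phi> + \<epsilon>" using f(3) by simp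
  qed
  have "((\<lambda>t. c t * \<bar>a t\<bar>) has_sum (\<Sum>i\<in>S. b i * mass a i)) UNIV"
    unfolding c_def by (rule mass_sum[OF a S(1)])
  then have "(\<Sum>i\<in>S. b i * mass a i) \<le> dual_norm le nrm \<phi>"
    by (rule has_sum_le_finite_sums) (use fin in auto)
  moreover have "(\<Sum>i\<in>S. b i * mass a i) = s"
  proof -
    have "(\<Sum>i\<in>S. b i * mass a i) = (1 / s) * (\<Sum>i\<in>S. (mass a i)\<^sup>2)"
      unfolding b_def by (simp add: sum_distrib_left power2_eq_square)
    also have "(\<Sum>i\<in>S. (mass a i)\<^sup>2) = s\<^sup>2"
      unfolding s_def L2_set_def by (simp add: sum_nonneg)
    finally show ?thesis using s by (simp add: power2_eq_square)
  qed
  ultimately show ?thesis unfolding s_def by simp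
qed

text \<open>Both parts together: the squared dual norm is the supremum of the finite sums of squares
  of masses. If the second part failed, \<open>dual_nrm_least\<close> would give a smaller
  bound.\<close>

lemma dual_nrm_squared:
  shows "\<And>S. finite S \<Longrightarrow> S \<subseteq> Ix \<Longrightarrow> (\<Sum>i\<in>S. (mass a i)\<^sup>2) \<le> (dual_norm le nrm \<phi>)\<^sup>2"
    and "\<And>\<epsilon>. 0 < \<epsilon> \<Longrightarrow>
      \<exists>S. finite S \<and> S \<subseteq> Ix \<and> (dual_norm le nrm \<phi>)\<^sup>2 - \<epsilon> \<le> (\<Sum>i\<in>S. (mass a i)\<^sup>2)"
proof -
  let ?D = "dual_norm le nrm \<phi>"
  show "(\<Sum>i\<in>S. (mass a i)\<^sup>2) \<le> ?D\<^sup>2" if "finite S" "S \<subseteq> Ix" for S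
    using power_mono[OF mass_le_dual_nrm[OF that], of 2] by (simp add: L2_set_def sum_nonneg)
  fix \<epsilon> :: real assume "0 < \<epsilon>"
  show "\<exists>S. finite S \<and> S \<subseteq> Ix \<and> ?D\<^sup>2 - \<epsilon> \<le> (\<Sum>i\<in>S. (mass a i)\<^sup>2)"
  proof (rule ccontr)
    assume "\<not> (\<exists>S. finite S \<and> S \<subseteq> Ix \<and> ?D\<^sup>2 - \<epsilon> \<le> (\<Sum>i\<in>S. (mass a i)\<^sup>2))"
    then have lt: "(\<Sum>i\<in>S. (mass a i)\<^sup>2) < ?D\<^sup>2 - \<epsilon>" if "finite S" "S \<subseteq> Ix" for S
      using that by (simp add: not_le)
    have "?D \<le> sqrt (?D\<^sup>2 - \<epsilon>)"
      using lt by (intro dual_nrm_least) (simp add: L2_set_def less_imp_le)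
    then have "?D\<^sup>2 \<le> (sqrt (?D\<^sup>2 - \<epsilon>))\<^sup>2"
      by (rule power_mono[OF _ dual_nrm_nonneg])
    \<comment> \<open>The empty index set shows that the radicand is positive.\<close>
    also have "\<dots> = ?D\<^sup>2 - \<epsilon>" using lt[of "{}"] by simp
    finally show False using \<open>0 < \<epsilon>\<close> by simp
  qed
qed

end

text \<open>Strict convexity of \<open>\<ell>\<^sub>2\<close>, with the equation z = x + y weakened
  to an inequality. By the parallelogram identity the terms \<open>(x i - y i)\<^sup>2\<close> and
  \<open>(x i + y i)\<^sup>2 - (z i)\<^sup>2\<close>, all nonnegative, have total at most \<open>2 *
  D\<^sup>2 + 2 * D\<^sup>2 - ((2 * D)\<^sup>2 - \<epsilon>)\<close>, which is
  \<open>\<epsilon>\<close>.\<close>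

lemma l2_midpoint_rigidity:
  fixes x y z :: "'i \<Rightarrow> real" and D :: real
  assumes nonneg: "\<And>i. 0 \<le> x i" "\<And>i. 0 \<le> y i" "\<And>i. 0 \<le> z i" and le: "\<And>i. z i \<le> x i + y i"
    and x: "\<And>S. finite S \<Longrightarrow> S \<subseteq> I \<Longrightarrow> (\<Sum>i\<in>S. (x i)\<^sup>2) \<le> D\<^sup>2"
    and y: "\<And>S. finite S \<Longrightarrow> S \<subseteq> I \<Longrightarrow> (\<Sum>i\<in>S. (y i)\<^sup>2) \<le> D\<^sup>2"
    and z: "\<And>\<epsilon>. 0 < \<epsilon> \<Longrightarrow> \<exists>S. finite S \<and> S \<subseteq> I \<and> (2 * D)\<^sup>2 - \<epsilon> \<le> (\<Sum>i\<in>S. (z i)\<^sup>2)"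
    and k: "k \<in> I"
  shows "x k = y k" "z k = x k + y k"
proof -
  have main: "(x k - y k)\<^sup>2 \<le> \<epsilon> \<and> (x k + y k)\<^sup>2 - (z k)\<^sup>2 \<le> \<epsilon>" if "0 < \<epsilon>" for \<epsilon>
  proof -
    from z[OF that] obtain S where S: "finite S" "S \<subseteq> I" "(2 * D)\<^sup>2 - \<epsilon> \<le> (\<Sum>i\<in>S. (z i)\<^sup>2)"
      by (elim exE conjE)
    \<comment> \<open>Including \<open>k\<close> can only increase the sum for \<open>z\<close>,
      while the bounds for \<open>x\<close> and \<open>y\<close> hold on every finite
      subset.\<close>
    define T where "T = insert k S"
    have T: "finite T" "T \<subseteq> I" "k \<in> T" using S k unfolding T_def by auto
    have zT: "(2 * D)\<^sup>2 - \<epsilon> \<le> (\<Sum>i\<in>T. (z i)\<^sup>2)"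
      using S(3) sum_mono2[of T S "\<lambda>i. (z i)\<^sup>2"] T(1) unfolding T_def
      by (simp add: subset_insertI)
    have sq: "(z i)\<^sup>2 \<le> (x i + y i)\<^sup>2" for i using nonneg(3) le by (intro power_mono) auto
    have "(\<Sum>i\<in>T. (z i)\<^sup>2) \<le> (\<Sum>i\<in>T. (x i + y i)\<^sup>2)" by (intro sum_mono sq)
    moreover have par: "(\<Sum>i\<in>T. (x i + y i)\<^sup>2) + (\<Sum>i\<in>T. (x i - y i)\<^sup>2) =
        2 * (\<Sum>i\<in>T. (x i)\<^sup>2) + 2 * (\<Sum>i\<in>T. (y i)\<^sup>2)"
      unfolding sum.distrib[symmetric] sum_distrib_left
      by (intro sum.cong) (auto simp: power2_eq_square algebra_simps)
    moreover have "(2 * D)\<^sup>2 = 4 * D\<^sup>2" by (simp add: power2_eq_square)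
    moreover note zT x[OF T(1,2)] y[OF T(1,2)]
    ultimately have "(\<Sum>i\<in>T. (x i - y i)\<^sup>2) \<le> \<epsilon>"
      and "(\<Sum>i\<in>T. (x i + y i)\<^sup>2) + (\<Sum>i\<in>T. (x i - y i)\<^sup>2) - (\<Sum>i\<in>T. (z i)\<^sup>2) \<le> \<epsilon>"
      by linarith+
    moreover have "0 \<le> (\<Sum>i\<in>T. (x i - y i)\<^sup>2)" by (simp add: sum_nonneg)
    moreover have "(x k - y k)\<^sup>2 \<le> (\<Sum>i\<in>T. (x i - y i)\<^sup>2)"
      by (intro member_le_sum T) auto
    moreover have "(x k + y k)\<^sup>2 - (z k)\<^sup>2 \<le> (\<Sum>i\<in>T. (x i + y i)\<^sup>2 - (z i)\<^sup>2)"
      using sq T by (intro member_le_sum[where f = "\<lambda>i. (x i + y i)\<^sup>2 - (z i)\<^sup>2"]) auto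
    ultimately show ?thesis unfolding sum_subtractf by linarith
  qed
  have "(x k - y k)\<^sup>2 \<le> 0" by (rule field_le_epsilon) (use main in simp)
  then show "x k = y k" by simp
  have "(x k + y k)\<^sup>2 - (z k)\<^sup>2 \<le> 0" by (rule field_le_epsilon) (use main in simp)
  then have "x k + y k \<le> z k" by (intro power2_le_imp_le[OF _ nonneg(3)]) simp
  then show "z k = x k + y k" using le[of k] by simp
qed

lemma mass_eq:
  assumes "U \<in> Us n"
  shows "mass a (n, U) = (1/2) ^ n * (\<Sum>\<^sub>\<infinity>t\<in>U. \<bar>a t\<bar>)"
proof -
  have "mass a (n, U) = (\<Sum>\<^sub>\<infinity>t\<in>U. (1/2) ^ n * \<bar>a t\<bar>)"
    unfolding mass_def wt_def by (intro infsum_cong_neutral) (auto simp: indicator_def)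
  also have "\<dots> = (1/2) ^ n * (\<Sum>\<^sub>\<infinity>t\<in>U. \<bar>a t\<bar>)" by (rule infsum_cmult_right')
  finally show ?thesis .
qed

text \<open>Rigidity is applied to the mass families of \<open>a\<close>, \<open>b\<close> and their
  sum. At \<open>(0, UNIV)\<close> it makes total variation additive, so the nonnegative terms
  \<open>\<bar>a t\<bar> + \<bar>b t\<bar> - \<bar>a t + b t\<bar>\<close> sum to zero.\<close>

lemma dual_nrm_midpoint:
  assumes \<phi>: "\<phi> \<in> C0_dual le" and a: "a summable_on UNIV" "\<And>f. f \<in> C \<Longrightarrow> \<phi> f = (\<Sum>\<^sub>\<infinity>t. a t * f t)"
    and \<psi>: "\<psi> \<in> C0_dual le" and b: "b summable_on UNIV" "\<And>f. f \<in> C \<Longrightarrow> \<psi> f = (\<Sum>\<^sub>\<infinity>t. b t * f t)"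
    and eq: "dual_norm le nrm \<phi> = dual_norm le nrm \<psi>"
      "dual_norm le nrm \<psi> = dual_norm le nrm (\<lambda>f. \<phi> f + \<psi> f) / 2"
  shows "U \<in> Us n \<Longrightarrow> (\<Sum>\<^sub>\<infinity>t\<in>U. \<bar>a t\<bar>) = (\<Sum>\<^sub>\<infinity>t\<in>U. \<bar>b t\<bar>)"
    and "\<bar>a t + b t\<bar> = \<bar>a t\<bar> + \<bar>b t\<bar>"
proof -
  define D where "D = dual_norm le nrm \<phi>"
  \<comment> \<open>This series agrees with the sum of the two functionals on \<open>C\<close>,
    hence has the same dual norm, and it comes with a representing family.\<close>
  define \<theta> where "\<theta> f = (\<Sum>\<^sub>\<infinity>t. (a t + b t) * f t)" for f
  have ab: "(\<lambda>t. a t + b t) summable_on UNIV" by (rule summable_on_add[OF a(1) b(1)])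
  have "\<theta> \<in> C0_dual le" unfolding \<theta>_def by (rule sum_functional_dual[OF ab])
  have \<theta>: "\<theta> f = \<phi> f + \<psi> f" if "f \<in> C" for f
    unfolding \<theta>_def using a(2)[OF that] b(2)[OF that]
      infsum_add[OF summable_mult_bounded(2)[OF a(1) abs_le_supnorm[OF that]]
        summable_mult_bounded(2)[OF b(1) abs_le_supnorm[OF that]]]
    by (simp add: distrib_right)
  have "dual_norm le nrm \<theta> = dual_norm le nrm (\<lambda>f. \<phi> f + \<psi> f)"
    unfolding dual_norm_def using \<theta> by (intro SUP_cong) auto
  then have D: "dual_norm le nrm \<psi> = D" "dual_norm le nrm \<theta> = 2 * D"
    using eq unfolding D_def by simp_all
  have abs: "(\<lambda>t. \<bar>h t\<bar>) summable_on UNIV" if "h summable_on UNIV" for h :: "'a \<Rightarrow> real"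
    using that summable_on_iff_abs_summable_on_real[of h UNIV] by simp
  have le: "mass (\<lambda>t. a t + b t) i \<le> mass a i + mass b i" for i
  proof -
    have "mass (\<lambda>t. a t + b t) i \<le> (\<Sum>\<^sub>\<infinity>t. \<bar>a t\<bar> * wt i t + \<bar>b t\<bar> * wt i t)"
      unfolding mass_def
    proof (intro infsum_mono mass_summable ab summable_on_add a(1) b(1))
      show "\<bar>a t + b t\<bar> * wt i t \<le> \<bar>a t\<bar> * wt i t + \<bar>b t\<bar> * wt i t" for t
        using mult_right_mono[OF abs_triangle_ineq wt_nonneg, of "a t" "b t" i t]
        by (simp add: distrib_right)
    qed
    also have "\<dots> = mass a i + mass b i"
      unfolding mass_def by (intro infsum_add mass_summable a(1) b(1))
    finally show ?thesis .
  qed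
  have rigid: "mass a i = mass b i" "mass (\<lambda>t. a t + b t) i = mass a i + mass b i" if i: "i \<in> Ix" for i
  proof -
    note bounds = mass_nonneg[of a] mass_nonneg[of b] mass_nonneg[of "\<lambda>t. a t + b t"] le
    have x: "(\<Sum>i\<in>S. (mass a i)\<^sup>2) \<le> D\<^sup>2" if "finite S" "S \<subseteq> Ix" for S
      using dual_nrm_squared(1)[OF \<phi> a that] unfolding D_def .
    have y: "(\<Sum>i\<in>S. (mass b i)\<^sup>2) \<le> D\<^sup>2" if "finite S" "S \<subseteq> Ix" for S
      using dual_nrm_squared(1)[OF \<psi> b that] unfolding D(1) .
    have z: "\<exists>S. finite S \<and> S \<subseteq> Ix \<and> (2 * D)\<^sup>2 - \<epsilon> \<le> (\<Sum>i\<in>S. (mass (\<lambda>t. a t + b t) i)\<^sup>2)"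
      if "0 < \<epsilon>" for \<epsilon>
      using dual_nrm_squared(2)[OF \<open>\<theta> \<in> C0_dual le\<close> ab \<theta>_def that] unfolding D(2) .
    show "mass a i = mass b i" by (rule l2_midpoint_rigidity(1)[OF bounds x y z i])
    show "mass (\<lambda>t. a t + b t) i = mass a i + mass b i"
      by (rule l2_midpoint_rigidity(2)[OF bounds x y z i])
  qed
  show "(\<Sum>\<^sub>\<infinity>t\<in>U. \<bar>a t\<bar>) = (\<Sum>\<^sub>\<infinity>t\<in>U. \<bar>b t\<bar>)" if "U \<in> Us n"
    using rigid(1)[of "(n, U)"] that mass_eq[OF that] by simp
  have U0: "UNIV \<in> Us 0" using Us_0 by simp
  have "(\<Sum>\<^sub>\<infinity>t. \<bar>a t + b t\<bar>) = (\<Sum>\<^sub>\<infinity>t. \<bar>a t\<bar>) + (\<Sum>\<^sub>\<infinity>t. \<bar>b t\<bar>)"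
    using rigid(2)[of "(0, UNIV)"] U0 mass_eq[OF U0] by simp
  also have "\<dots> = (\<Sum>\<^sub>\<infinity>t. \<bar>a t\<bar> + \<bar>b t\<bar>)"
    by (rule infsum_add[symmetric, OF abs[OF a(1)] abs[OF b(1)]])
  finally have "(\<Sum>\<^sub>\<infinity>t. (\<bar>a t\<bar> + \<bar>b t\<bar>) - \<bar>a t + b t\<bar>) = 0"
    using infsum_add[OF summable_on_add[OF abs[OF a(1)] abs[OF b(1)]] summable_on_uminus[THEN iffD2, OF abs[OF ab]]]
    by (simp add: infsum_uminus)
  moreover have "(\<lambda>t. (\<bar>a t\<bar> + \<bar>b t\<bar>) - \<bar>a t + b t\<bar>) summable_on UNIV"
    using summable_on_add[OF summable_on_add[OF abs[OF a(1)] abs[OF b(1)]] summable_on_uminus[THEN iffD2, OF abs[OF ab]]]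
    by simp
  ultimately have "(\<bar>a t\<bar> + \<bar>b t\<bar>) - \<bar>a t + b t\<bar> = 0"
    using nonneg_infsum_le_0D[of "\<lambda>t. (\<bar>a t\<bar> + \<bar>b t\<bar>) - \<bar>a t + b t\<bar>" UNIV t]
    by (simp add: abs_triangle_ineq)
  then show "\<bar>a t + b t\<bar> = \<bar>a t\<bar> + \<bar>b t\<bar>" by simp
qed

end

section \<open>Wedges above jumps\<close>

locale plateau_tree = hausdorff_tree +
  fixes \<rho> :: "'a \<Rightarrow> real"
  assumes \<rho>_mono: "le s t \<Longrightarrow> \<rho> s \<le> \<rho> t"
    and no_const_seq: "\<not> (\<exists>seq :: nat \<Rightarrow> 'a. (\<forall>n. tree_lt le (seq n) (seq (Suc n))) \<and>
                                (\<forall>n. \<rho> (seq n) = \<rho> (seq 0)))"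
begin

text \<open>Below a limit \<open>u\<close> one could climb from \<open>r\<close> forever, giving a
  strictly increasing sequence on which \<open>\<rho>\<close> is constant.\<close>

lemma plateau_nonlim:
  assumes "lt r u" "\<And>s. le r s \<Longrightarrow> lt s u \<Longrightarrow> \<rho> s = \<rho> r"
  shows "nonlim u"
proof (rule ccontr)
  assume lim: "\<not> nonlim u"
  have "\<exists>f. \<forall>n. (le r (f n) \<and> lt (f n) u) \<and> lt (f n) (f (Suc n))"
  proof (rule dependent_nat_choice)
    show "\<exists>x. le r x \<and> lt x u" using assms(1) le_refl by blast
    fix x :: 'a and n :: nat assume x: "le r x \<and> lt x u"
    then obtain y where "lt x y" "lt y u" using limit_above[OF lim] by blast
    then have "le r y" using x le_trans[of r x y] lt_imp_le by simp
    then show "\<exists>y. (le r y \<and> lt y u) \<and> lt x y" using \<open>lt x y\<close> \<open>lt y u\<close> by blast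
  qed
  then obtain f where f: "\<forall>n. (le r (f n) \<and> lt (f n) u) \<and> lt (f n) (f (Suc n))" by (elim exE)
  then have "\<forall>n. \<rho> (f n) = \<rho> (f 0)" using assms(2) by simp
  then show False using no_const_seq f by blast
qed

text \<open>Roots qualify vacuously. Being isolated makes the wedge open; the strict rise leaves
  room for a rational threshold.\<close>

definition jump :: "'a \<Rightarrow> bool" where
  "jump u \<longleftrightarrow> nonlim u \<and> (\<forall>r. lt r u \<longrightarrow> \<rho> r < \<rho> u)"

text \<open>Since \<open>w\<close> is a limit, \<open>\<rho>\<close> cannot be constant from
  \<open>r\<close> up to \<open>w\<close>. The first \<open>u\<close> with \<open>\<rho> u\<close>
  above \<open>\<rho> r\<close> is a jump: \<open>\<rho>\<close> is constant from \<open>r\<close>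
  until just before \<open>u\<close>, so \<open>u\<close> is not a limit.\<close>

lemma jump_cofinal:
  assumes lim: "\<not> nonlim w" and r: "lt r w"
  obtains u where "jump u" "lt u w" "le r u"
proof -
  obtain s where s: "le r s" "lt s w" "\<rho> s \<noteq> \<rho> r"
    using plateau_nonlim[OF r] lim by blast
  then have "\<rho> r < \<rho> s" using \<rho>_mono[OF s(1)] by simp
  then obtain u where u: "le u w" "lt u w \<and> \<rho> r < \<rho> u"
    "\<And>x. le x w \<Longrightarrow> lt x w \<and> \<rho> r < \<rho> x \<Longrightarrow> le u x"
    using least_below[of s w "\<lambda>x. lt x w \<and> \<rho> r < \<rho> x"] s(2) lt_imp_le by blast
  have ru: "lt r u"
    using le_or_lt_below[OF u(1) lt_imp_le[OF r]] \<rho>_mono[of u r] u(2) by auto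
  have below: "\<rho> x \<le> \<rho> r" if "lt x u" for x
  proof (rule ccontr)
    assume "\<not> \<rho> x \<le> \<rho> r"
    moreover have "lt x w" using lt_le_trans[OF that u(1)] .
    ultimately have "le u x" using u(3)[of x] lt_imp_le by simp
    then show False using lt_not_le[OF that] by simp
  qed
  have "nonlim u"
    using below \<rho>_mono by (intro plateau_nonlim[OF ru] antisym) auto
  moreover have "\<rho> x < \<rho> u" if "lt x u" for x using below[OF that] u(2) by simp
  ultimately have "jump u" unfolding jump_def by blast
  then show thesis using that u(2) lt_imp_le[OF ru] by blast
qed

text \<open>Measures agreeing (in absolute value) on isolated points and on the wedges above jumps agree
  at each limit \<open>w\<close>: the mass of \<open>up w\<close> is a limit of masses of such wedges, and what remains of
  \<open>up w\<close> after removing \<open>w\<close> and the wedges above the exits \<open>v\<close> of the plateau of \<open>w\<close> consists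
  of isolated points.\<close>

lemma zero_if_zero_on_wedges:
  fixes h :: "'a \<Rightarrow> real"
  assumes h: "h summable_on UNIV" and iso: "\<And>t. nonlim t \<Longrightarrow> h t = 0"
    and wedge: "\<And>u. jump u \<Longrightarrow> infsum h (up u) = 0"
  shows "h w = 0"
proof (cases "nonlim w")
  case False
  have sub: "h summable_on A" for A by (rule summable_on_subset[OF h]) simp
  have abs: "(\<lambda>t. \<bar>h t\<bar>) summable_on A" for A
    using sub summable_on_iff_abs_summable_on_real[of h A] by simp
  have "\<bar>infsum h (up w)\<bar> \<le> 0 + \<epsilon>" if \<epsilon>: "0 < \<epsilon>" for \<epsilon>
  proof -
    obtain F where F: "finite F" "(\<Sum>\<^sub>\<infinity>t\<in>-F. \<bar>h t\<bar>) \<le> \<epsilon>"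
      using summable_tail[OF h \<epsilon>] .
    \<comment> \<open>A point outside \<open>up w\<close> already fails to lie above some
      predecessor of \<open>w\<close>, by \<open>limit_le\<close>; for finitely many points the
      largest of these predecessors works.\<close>
    have "\<exists>r. lt r w \<and> (\<forall>x\<in>G. \<not> le r x)" if "finite G" "G \<inter> up w = {}" for G
      using that
    proof (induction G rule: finite_induct)
      case empty
      then show ?case using False unfolding nonlim_def by blast
    next
      case (insert x G)
      then obtain r where r: "lt r w" "\<forall>x\<in>G. \<not> le r x" by blast
      have "\<not> le w x" using insert.prems by blast
      then obtain r' where r': "lt r' w" "\<not> le r' x" using limit_le[OF False, of x] by blast
      have "le r r' \<or> le r' r" using le_linear_below lt_imp_le[OF r(1)] lt_imp_le[OF r'(1)] by simp
      then show ?case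
      proof
        assume "le r r'"
        then have "\<forall>y\<in>insert x G. \<not> le r' y" using r(2) r'(2) le_trans by blast
        then show ?thesis using r'(1) by blast
      next
        assume "le r' r"
        then have "\<forall>y\<in>insert x G. \<not> le r y" using r(2) r'(2) le_trans by blast
        then show ?thesis using r(1) by blast
      qed
    qed
    then obtain r where r: "lt r w" "\<forall>x\<in>F - up w. \<not> le r x" using F(1) by (metis Diff_disjoint Int_commute finite_Diff)
    obtain u where u: "jump u" "lt u w" "le r u" by (rule jump_cofinal[OF False r(1)])
    have sub_u: "up w \<subseteq> up u" using u(2) lt_imp_le le_trans by blast
    \<comment> \<open>A point of \<open>F\<close> in \<open>up u\<close> lies above
      \<open>r\<close>, so by the choice of \<open>r\<close> it belongs to
      \<open>up w\<close>.\<close>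
    have "up u - up w \<subseteq> -F" using r(2) u(3) le_trans by blast
    have "infsum h (up u) = infsum h (up w) + infsum h (up u - up w)"
      using infsum_Un_disjoint[OF sub sub, of "up w" "up u - up w"] sub_u by (simp add: Un_absorb1)
    then have "\<bar>infsum h (up w)\<bar> = \<bar>infsum h (up u - up w)\<bar>" using wedge[OF u(1)] by simp
    also have "\<dots> \<le> (\<Sum>\<^sub>\<infinity>t\<in>up u - up w. \<bar>h t\<bar>)"
      using norm_infsum_bound[of h "up u - up w"] abs by simp
    also have "\<dots> \<le> (\<Sum>\<^sub>\<infinity>t\<in>-F. \<bar>h t\<bar>)"
      by (intro infsum_mono2 abs \<open>up u - up w \<subseteq> -F\<close>) auto
    finally show ?thesis using F(2) by simp
  qed
  then have "\<bar>infsum h (up w)\<bar> \<le> 0" by (rule field_le_epsilon)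
  then have zero: "infsum h (up w) = 0" by simp
  \<comment> \<open>The exits of the plateau: the first points above \<open>w\<close> where
    \<open>\<rho>\<close> exceeds \<open>\<rho> w\<close>.\<close>
  define V where "V = {v. lt w v \<and> \<rho> w < \<rho> v \<and> (\<forall>x. le w x \<longrightarrow> lt x v \<longrightarrow> \<rho> x = \<rho> w)}"
  define W where "W = (\<Union>v\<in>V. up v)"
  have jumpV: "jump v" if "v \<in> V" for v
  proof -
    have v: "lt w v" "\<rho> w < \<rho> v" "\<And>x. le w x \<Longrightarrow> lt x v \<Longrightarrow> \<rho> x = \<rho> w"
      using that unfolding V_def by auto
    have "nonlim v" using v(3) by (rule plateau_nonlim[OF v(1)])
    moreover have "\<rho> r < \<rho> v" if "lt r v" for r
      using le_or_lt_below[OF lt_imp_le[OF that] lt_imp_le[OF v(1)]] v(2) v(3)[of r] \<rho>_mono[of r w]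
        that lt_imp_le[of w r] by auto
    ultimately show ?thesis unfolding jump_def by blast
  qed
  have exits: "v = v'" if "v \<in> V" "v' \<in> V" "le v t" "le v' t" for v v' t
  proof (rule ccontr)
    assume "v \<noteq> v'"
    then have "lt v v' \<or> lt v' v" using le_linear_below[OF that(3,4)] by (auto simp: tree_lt_def)
    then show False using that(1,2) lt_imp_le unfolding V_def by auto
  qed
  \<comment> \<open>Wedges above distinct exits are disjoint, so the sum over \<open>W\<close>
    splits into sums over single wedges, each of which is zero.\<close>
  have inj: "inj_on snd (Sigma V up)"
    using exits by (auto simp: inj_on_def)
  have img: "snd ` Sigma V up = W" unfolding W_def by force
  have "infsum h W = infsum (h \<circ> snd) (Sigma V up)"
    using infsum_reindex[OF inj, of h] img by simp
  also have "\<dots> = (\<Sum>\<^sub>\<infinity>v\<in>V. infsum (\<lambda>t. (h \<circ> snd) (v, t)) (up v))"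
  proof (rule infsum_Sigma_banach[symmetric])
    show "(h \<circ> snd) summable_on Sigma V up"
      using summable_on_reindex[OF inj, of h] img sub by simp
  qed
  also have "\<dots> = (\<Sum>\<^sub>\<infinity>v\<in>V. 0)"
    using wedge[OF jumpV] by (intro infsum_cong) simp
  finally have W0: "infsum h W = 0" by simp
  \<comment> \<open>A limit \<open>t\<close> strictly above \<open>w\<close> would have an exit
    \<open>v\<close> below it, by \<open>plateau_nonlim\<close>, and so lie in \<open>W\<close>.
    Hence the remaining points are isolated.\<close>
  have rest: "h t = 0" if t: "le w t" "t \<noteq> w" "t \<notin> W" for t
  proof (rule iso, rule ccontr)
    assume "\<not> nonlim t"
    have wt: "lt w t" using t by (simp add: tree_lt_def)
    then obtain s where s: "le w s" "lt s t" "\<rho> s \<noteq> \<rho> w"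
      using plateau_nonlim[OF wt] \<open>\<not> nonlim t\<close> by blast
    then have "\<rho> w < \<rho> s" using \<rho>_mono[OF s(1)] by simp
    then obtain v where v: "le v t" "le w v \<and> \<rho> w < \<rho> v"
      "\<And>x. le x t \<Longrightarrow> le w x \<and> \<rho> w < \<rho> x \<Longrightarrow> le v x"
      using least_below[of s t "\<lambda>x. le w x \<and> \<rho> w < \<rho> x"] s lt_imp_le by blast
    have "lt w v" using v(2) by (auto simp: tree_lt_def)
    moreover have "\<rho> x = \<rho> w" if "le w x" "lt x v" for x
    proof (rule ccontr)
      assume "\<rho> x \<noteq> \<rho> w"
      then have "\<rho> w < \<rho> x" using \<rho>_mono[OF that(1)] by simp
      then have "le v x" using v(3)[of x] that le_trans[OF lt_imp_le[OF that(2)] v(1)] by simp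
      then show False using lt_not_le[OF that(2)] by simp
    qed
    ultimately have "v \<in> V" using v(2) unfolding V_def by simp
    then show False using t(3) v(1) unfolding W_def by blast
  qed
  have "w \<notin> W" using lt_not_le unfolding W_def V_def by blast
  have "W \<subseteq> up w" using le_trans lt_imp_le unfolding W_def V_def by blast
  then have "infsum h (up w) = infsum h (insert w W)"
    using rest le_refl by (intro infsum_cong_neutral) auto
  also have "\<dots> = h w" using infsum_insert[OF sub \<open>w \<notin> W\<close>] W0 by simp
  finally show ?thesis using zero by simp
qed (rule iso)

section \<open>The wedge families and strict convexity\<close>

definition threshold :: "nat \<Rightarrow> real" where
  "threshold n = of_rat (nat_to_rat_surj n)"

text \<open>The shift by two reserves level 0 for the whole space, as \<open>open_families\<close>
  demands, and level 1 for the isolated points.\<close>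

fun wedges :: "nat \<Rightarrow> 'a set set" where
  "wedges 0 = {UNIV}"
| "wedges (Suc 0) = {{t} | t. nonlim t}"
| "wedges (Suc (Suc n)) =
    {up u | u. nonlim u \<and> threshold n \<le> \<rho> u \<and> (\<forall>r. lt r u \<longrightarrow> \<rho> r < threshold n)}"

text \<open>A uniform gap below \<open>\<rho> u\<close> is required: its lower end \<open>c\<close>
  is the value at the immediate predecessor, or \<open>\<rho> u - 1\<close> at a root. Any rational
  strictly inside the gap is a suitable threshold.\<close>

lemma jump_in_wedges:
  assumes "jump u"
  shows "\<exists>n. up u \<in> wedges n"
proof -
  have "\<exists>c<\<rho> u. \<forall>r. lt r u \<longrightarrow> \<rho> r \<le> c"
  proof (cases "\<exists>p. lt p u \<and> (\<forall>s. lt s u \<longrightarrow> le s p)")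
    case True
    then obtain p where "lt p u" "\<forall>s. lt s u \<longrightarrow> le s p" by blast
    then show ?thesis using assms \<rho>_mono unfolding jump_def by blast
  next
    case False
    then have "\<forall>r. \<not> lt r u" using assms unfolding jump_def nonlim_def by blast
    then show ?thesis by (intro exI[of _ "\<rho> u - 1"]) simp
  qed
  then obtain c where c: "c < \<rho> u" "\<forall>r. lt r u \<longrightarrow> \<rho> r \<le> c" by blast
  obtain q where q: "c < of_rat q" "of_rat q < \<rho> u" using of_rat_dense[OF c(1)] by blast
  obtain n where "q = nat_to_rat_surj n" using surj_nat_to_rat_surj by (metis surjD)
  then have n: "c < threshold n" "threshold n \<le> \<rho> u" using q unfolding threshold_def by simp_all
  have "\<forall>r. lt r u \<longrightarrow> \<rho> r < threshold n" using c(2) n(1) by (meson le_less_trans)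
  then have "up u \<in> wedges (Suc (Suc n))" using n(2) assms unfolding jump_def by auto
  then show ?thesis by blast
qed

sublocale open_families le wedges
proof
  show "wedges 0 = {UNIV}" by simp
  show "openin X U" if "U \<in> wedges n" for U n
    using that openin_topspace[of X] openin_up openin_singleton
    by (cases n rule: wedges.cases) auto
  show "U \<inter> V = {}" if UV: "U \<in> wedges n" "V \<in> wedges n" "U \<noteq> V" for U V n
  proof (cases n rule: wedges.cases)
    case (3 m)
    obtain u v where u: "U = up u" "threshold m \<le> \<rho> u" "\<forall>r. lt r u \<longrightarrow> \<rho> r < threshold m"
      and v: "V = up v" "threshold m \<le> \<rho> v" "\<forall>r. lt r v \<longrightarrow> \<rho> r < threshold m"
      using UV(1,2) 3 by auto
    \<comment> \<open>The smaller of two comparable points would have \<open>\<rho>\<close> both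
      below the threshold and at least the threshold.\<close>
    have "\<not> lt u v" "\<not> lt v u" using u v by (meson not_le)+
    then show ?thesis
      using UV(3) le_or_lt_below le_antisym unfolding u(1) v(1) by blast
  qed (use UV in auto)
qed

text \<open>Equal masses on all wedges give \<open>\<bar>a t\<bar> = \<bar>b t\<bar>\<close> by
  \<open>zero_if_zero_on_wedges\<close>; absence of cancellation then forces equal signs.\<close>

lemma dual_strictly_convex_nrm: "dual_strictly_convex le nrm"
  unfolding dual_strictly_convex_def
proof (intro ballI impI, elim conjE)
  fix \<phi> \<psi> f
  assume \<phi>: "\<phi> \<in> C0_dual le" and \<psi>: "\<psi> \<in> C0_dual le"
    and eq: "dual_norm le nrm \<phi> = dual_norm le nrm \<psi>"
      "dual_norm le nrm \<psi> = dual_norm le nrm (\<lambda>f. \<phi> f + \<psi> f) / 2"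
    and f: "f \<in> C"
  obtain a where a: "a summable_on UNIV" "\<And>f. f \<in> C \<Longrightarrow> \<phi> f = (\<Sum>\<^sub>\<infinity>t. a t * f t)"
    by (rule dual_representation[OF \<phi>]) blast
  obtain b where b: "b summable_on UNIV" "\<And>f. f \<in> C \<Longrightarrow> \<psi> f = (\<Sum>\<^sub>\<infinity>t. b t * f t)"
    by (rule dual_representation[OF \<psi>]) blast
  have mass: "(\<Sum>\<^sub>\<infinity>t\<in>U. \<bar>a t\<bar>) = (\<Sum>\<^sub>\<infinity>t\<in>U. \<bar>b t\<bar>)" if "U \<in> wedges n" for U n
    using dual_nrm_midpoint(1)[OF \<phi> a \<psi> b eq that] .
  have aligned: "\<bar>a t + b t\<bar> = \<bar>a t\<bar> + \<bar>b t\<bar>" for t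
    using dual_nrm_midpoint(2)[OF \<phi> a \<psi> b eq] .
  have abs: "(\<lambda>t. \<bar>a t\<bar>) summable_on A" "(\<lambda>t. \<bar>b t\<bar>) summable_on A" for A
    using summable_on_subset[OF a(1), of A] summable_on_subset[OF b(1), of A]
      summable_on_iff_abs_summable_on_real[of a A] summable_on_iff_abs_summable_on_real[of b A] by simp_all
  have diff: "((\<lambda>t. \<bar>a t\<bar> - \<bar>b t\<bar>) has_sum (\<Sum>\<^sub>\<infinity>t\<in>A. \<bar>a t\<bar>) - (\<Sum>\<^sub>\<infinity>t\<in>A. \<bar>b t\<bar>)) A" for A
    using has_sum_add[OF has_sum_infsum[OF abs(1)] has_sum_uminusI[OF has_sum_infsum[OF abs(2)]]]
    by simp
  have zero: "\<bar>a t\<bar> - \<bar>b t\<bar> = 0" for t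
  proof (rule zero_if_zero_on_wedges)
    show "(\<lambda>t. \<bar>a t\<bar> - \<bar>b t\<bar>) summable_on UNIV"
      using diff by (rule has_sum_imp_summable)
    show "\<bar>a t\<bar> - \<bar>b t\<bar> = 0" if "nonlim t" for t
    proof -
      have "{t} \<in> wedges (Suc 0)" using that by auto
      from mass[OF this] show ?thesis by simp
    qed
    show "(\<Sum>\<^sub>\<infinity>t\<in>up u. \<bar>a t\<bar> - \<bar>b t\<bar>) = 0" if u: "jump u" for u
    proof -
      obtain n where "up u \<in> wedges n" using jump_in_wedges[OF u] by blast
      from mass[OF this] show ?thesis using infsumI[OF diff, of "up u"] by simp
    qed
  qed
  have "a t = b t" for t using zero[of t] aligned[of t] by linarith
  then show "\<phi> f = \<psi> f" using a(2)[OF f] b(2)[OF f] by simp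
qed

end

theorem theorem7p1:
  fixes le :: "'a \<Rightarrow> 'a \<Rightarrow> bool" and \<rho> :: "'a \<Rightarrow> real"
  assumes "is_tree le"
    and "\<forall>s t. le s t \<longrightarrow> \<rho> s \<le> \<rho> t"
    and "\<not> (\<exists>seq :: nat \<Rightarrow> 'a. (\<forall>n. tree_lt le (seq n) (seq (Suc n))) \<and>
                                (\<forall>n. \<rho> (seq n) = \<rho> (seq 0)))"
  shows "\<exists>N. equivalent_norm le N \<and> dual_strictly_convex le N"
proof -
  interpret plateau_tree le \<rho>
    using assms by unfold_locales auto
  show ?thesis using equivalent_nrm dual_strictly_convex_nrm by blast
qed

end
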